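(* Let $r\ge s\ge0$ be integers with $r$ even, $n=2(r+s)$, and let $G(r,s)$ be the Cayley graph on $\mathbb{Z}_4^n$ whose connection set is the set of vectors of type $(r,s,r,s)$. Then the smallest adjacency eigenvalue of $G(r,s)$ satisfies $$\lambda_{\min}(G(r,s))=\lambda(0,1,n-2,1)=-\frac{\binom{n}{r,s,r,s}}{n-1}$$ in each of the following regimes: (R1) $s\ge2$ is fixed and $n$ is large enough (i.e., for each fixed $s\ge2$ there is $N$ such that this holds for all such $r$ with $n\ge N$); (R2) $s=\alpha\cdot\frac n2$ with fixed $0<\alpha\le0.17$ and $n$ large enough (i.e., for each such $\alpha$ there is $N$ such that this holds for all $n\ge N$ for which $s=\alpha n/2$ is an integer and $r=n/2-s$ is even with $r\ge s$).
   Context: For $\mathbf{v}\in\mathbb{Z}_4^n$, its type is $(t_0,t_1,t_2,t_3)$ where $t_k$ is the number of coordinates equal to $k$. The Cayley graph has vertex set $\mathbb{Z}_4^n$, with $\mathbf{u},\mathbf{w}$ adjacent iff $\mathbf{u}-\mathbf{w}$ has type $(r,s,r,s)$. Its eigenvalues are $\lambda(\mathbf{v})=\sum_{\mathbf{b}}\zeta_4^{\mathbf{b}\cdot\mathbf{v}}$ ($\mathbf{b}$ ranging over vectors of type $(r,s,r,s)$, $\zeta_4=\sqrt{-1}$, $\mathbf{b}\cdot\mathbf{v}=\sum_kb_kv_k\in\mathbb{Z}_4$), which depends only on the type $(t_0,t_1,t_2,t_3)$ of $\mathbf{v}$ and is denoted $\lambda(t_0,t_1,t_2,t_3)$. $\binom{n}{r,s,r,s}=\frac{n!}{(r!)^2(s!)^2}$.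 *)

theory Defs
  imports
    "HOL-Library.Numeral_Type"
    "Jordan_Normal_Form.Char_Poly"
begin

text \<open>
  The ring of integers modulo 4 is the numeral type \<^typ>\<open>4\<close>, and its \<open>n\<close>-fold power is the carrier
  \<open>carrier_vec n\<close> of vectors over it.
\<close>

definition vtype :: "4 vec \<Rightarrow> nat \<times> nat \<times> nat \<times> nat" where
  "vtype v =
    (card {i. i < dim_vec v \<and> v $ i = 0}, card {i. i < dim_vec v \<and> v $ i = 1},
     card {i. i < dim_vec v \<and> v $ i = 2}, card {i. i < dim_vec v \<and> v $ i = 3})"

definition connection_set :: "nat \<Rightarrow> nat \<Rightarrow> 4 vec set" where
  "connection_set r s = {b \<in> carrier_vec (2 * (r + s)). vtype b = (r, s, r, s)}"


text \<open>
  Adjacency spectrum of a finite graph with vertex set \<open>V\<close> and adjacency relation \<open>adj\<close>. The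
  library's matrices are indexed by initial segments of the naturals, so the vertices have to be
  enumerated; the spectrum does not depend on the enumeration. The matrices of interest are real and
  symmetric, hence only real eigenvalues are considered.
\<close>

definition adjacency_matrix :: "'v list \<Rightarrow> ('v \<Rightarrow> 'v \<Rightarrow> bool) \<Rightarrow> real mat" where
  "adjacency_matrix vs adj =
    mat (length vs) (length vs) (\<lambda>(i, j). if adj (vs ! i) (vs ! j) then 1 else 0)"

definition adjacency_eigenvalues :: "'v set \<Rightarrow> ('v \<Rightarrow> 'v \<Rightarrow> bool) \<Rightarrow> real set" where
  "adjacency_eigenvalues V adj =
    {x. \<exists>vs. distinct vs \<and> set vs = V \<and> eigenvalue (adjacency_matrix vs adj) x}"

definition cayley_adj :: "4 vec set \<Rightarrow> 4 vec \<Rightarrow> 4 vec \<Rightarrow> bool" where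
  "cayley_adj S u w \<longleftrightarrow> u - w \<in> S"

definition lambda_min :: "nat \<Rightarrow> nat \<Rightarrow> real" where
  "lambda_min r s =
    Min (adjacency_eigenvalues (carrier_vec (2 * (r + s))) (cayley_adj (connection_set r s)))"


text \<open>
  \<open>zeta4_pow x\<close> is \<open>\<i>\<close> raised to the power \<open>x\<close>; \<open>Rep_bit0\<close> returns the
  representative of \<open>x\<close> in \<open>{0..<4}\<close>.
\<close>

definition zeta4_pow :: "4 \<Rightarrow> complex" where
  "zeta4_pow x = \<i> ^ nat (Rep_bit0 x)"

lemma zeta4_pow_of_nat: "zeta4_pow (of_nat k) = \<i> ^ k"
proof -
  have "Rep_bit0 (of_nat k :: 4) = int k mod 4"
    using bit0.Rep_Abs_mod[where 'a = 2, of "int k"] by (simp add: bit0.of_nat_eq[where 'a = 2])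
  hence "nat (Rep_bit0 (of_nat k :: 4)) = k mod 4"
    by (simp add: nat_mod_distrib)
  moreover have "\<i> ^ k = \<i> ^ (k mod 4)"
  proof -
    have "\<i> ^ k = \<i> ^ (4 * (k div 4) + k mod 4)" by simp
    also have "\<dots> = (\<i> ^ 4) ^ (k div 4) * \<i> ^ (k mod 4)"
      by (simp only: power_add power_mult)
    also have "\<i> ^ 4 = 1" by (simp add: power4_eq_xxxx)
    finally show ?thesis by simp
  qed
  ultimately show ?thesis by (simp add: zeta4_pow_def)
qed

definition lambda_vec :: "nat \<Rightarrow> nat \<Rightarrow> 4 vec \<Rightarrow> complex" where
  "lambda_vec r s v = (\<Sum>b \<in> connection_set r s. zeta4_pow (b \<bullet> v))"

lemma Z4_cases: "x = 0 \<or> x = 1 \<or> x = 2 \<or> x = (3::4)"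
proof (cases x rule: bit0_cases)
  case (of_int z)
  hence "z = 0 \<or> z = 1 \<or> z = 2 \<or> z = 3" by auto
  with of_int show ?thesis by auto
qed

lemma vtype_eq_imp_permutes:
  assumes v: "v \<in> carrier_vec n" and w: "w \<in> carrier_vec n" and t: "vtype v = vtype w"
  obtains p where "bij_betw p {..<n} {..<n}" "\<And>i. i < n \<Longrightarrow> w $ p i = v $ i"
proof -
  have "\<exists>f. bij_betw f {i. i < n \<and> v $ i = k} {i. i < n \<and> w $ i = k}" for k :: 4
    by (rule finite_same_card_bij) (use Z4_cases[of k] v w t in \<open>auto simp: vtype_def\<close>)
  then obtain f where f: "\<And>k. bij_betw (f k) {i. i < n \<and> v $ i = k} {i. i < n \<and> w $ i = k}"
    by metis
  define p where "p i = f (v $ i) i" for i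
  have p: "p i < n \<and> w $ p i = v $ i" if "i < n" for i
    using bij_betwE[OF f[of "v $ i"]] that by (auto simp: p_def)
  have "inj_on p {..<n}"
  proof (rule inj_onI)
    fix i j assume ij: "i \<in> {..<n}" "j \<in> {..<n}" "p i = p j"
    hence "v $ i = v $ j" using p[of i] p[of j] by auto
    thus "i = j"
      using ij bij_betw_imp_inj_on[OF f[of "v $ i"]] by (auto simp: p_def dest: inj_onD)
  qed
  moreover have "p ` {..<n} \<subseteq> {..<n}" using p by auto
  ultimately have "bij_betw p {..<n} {..<n}"
    by (simp add: bij_betw_def endo_inj_surj)
  thus thesis using p that by blast
qed

lemma lambda_vec_cong_vtype:
  assumes v: "v \<in> carrier_vec (2 * (r + s))" and w: "w \<in> carrier_vec (2 * (r + s))"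
    and t: "vtype v = vtype w"
  shows "lambda_vec r s v = lambda_vec r s w"
proof -
  define n where "n = 2 * (r + s)"
  obtain p where p: "bij_betw p {..<n} {..<n}" "\<And>i. i < n \<Longrightarrow> w $ p i = v $ i"
    using vtype_eq_imp_permutes[OF v w t] unfolding n_def by blast
  define q where "q = the_inv_into {..<n} p"
  have q: "bij_betw q {..<n} {..<n}" unfolding q_def by (rule bij_betw_the_inv_into[OF p(1)])
  have pq: "p (q i) = i" "q (p i) = i" "p i < n" "q i < n" if "i < n" for i
    using that p(1) q f_the_inv_into_f_bij_betw[OF p(1), of i] the_inv_into_f_f[of p "{..<n}" i]
    by (auto simp: q_def bij_betw_def)
  define P where "P g b = vec n (\<lambda>i. b $ g i)" for g :: "nat \<Rightarrow> nat" and b :: "4 vec"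
  have ty: "vtype (P g b) = vtype b"
    if g: "bij_betw g {..<n} {..<n}" and b: "b \<in> carrier_vec n" for g b
  proof -
    have "card {i. i < n \<and> b $ g i = k} = card {i. i < n \<and> b $ i = k}" for k
    proof (rule bij_betw_same_card[of g])
      show "bij_betw g {i. i < n \<and> b $ g i = k} {i. i < n \<and> b $ i = k}"
        using g unfolding bij_betw_def by (auto simp: inj_on_def)
    qed
    moreover have "{i. i < n \<and> P g b $ i = k} = {i. i < n \<and> b $ g i = k}" for k
      by (auto simp: P_def)
    ultimately show ?thesis using b by (simp add: vtype_def P_def)
  qed
  have S: "P g b \<in> connection_set r s"
    if "bij_betw g {..<n} {..<n}" "b \<in> connection_set r s" for g b
    using ty[OF that(1), of b] that(2) by (auto simp: connection_set_def n_def P_def)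
  show ?thesis unfolding lambda_vec_def
  proof (rule sum.reindex_bij_witness[of _ "P p" "P q"])
    fix b assume b: "b \<in> connection_set r s"
    hence bn: "dim_vec b = n" by (auto simp: connection_set_def n_def)
    show "P p (P q b) = b" "P q (P p b) = b"
      using bn pq by (auto simp: P_def intro!: eq_vecI)
    show "P p b \<in> connection_set r s" "P q b \<in> connection_set r s"
      using S p(1) q b by auto
    have "P q b \<bullet> w = (\<Sum>i<n. b $ q i * w $ i)"
      using w by (simp add: scalar_prod_def P_def n_def atLeast0LessThan)
    also have "\<dots> = (\<Sum>i<n. b $ q (p i) * w $ p i)"
      by (rule sum.reindex_bij_betw[OF p(1), symmetric])
    also have "\<dots> = (\<Sum>i<n. b $ i * v $ i)"
      by (rule sum.cong) (use pq p(2) in auto)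
    also have "\<dots> = b \<bullet> v"
      using v by (simp add: scalar_prod_def n_def atLeast0LessThan)
    finally show "zeta4_pow (P q b \<bullet> w) = zeta4_pow (b \<bullet> v)" by simp
  qed
qed

text \<open>The common value of \<open>lambda_vec r s\<close> on all vectors of type \<open>t\<close>.\<close>

definition lambda_type :: "nat \<Rightarrow> nat \<Rightarrow> nat \<times> nat \<times> nat \<times> nat \<Rightarrow> complex" where
  "lambda_type r s t = the_elem (lambda_vec r s ` {v \<in> carrier_vec (2 * (r + s)). vtype v = t})"

lemma lambda_type_vtype:
  assumes "v \<in> carrier_vec (2 * (r + s))"
  shows "lambda_type r s (vtype v) = lambda_vec r s v"
proof -
  have "lambda_vec r s ` {w \<in> carrier_vec (2 * (r + s)). vtype w = vtype v} = {lambda_vec r s v}"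
    using assms lambda_vec_cong_vtype by blast
  thus ?thesis by (simp add: lambda_type_def)
qed

end

theory Submission
  imports Defs "HOL-Real_Asymp.Real_Asymp"
begin

text \<open>
  Splitting a vector \<open>b\<close> of type \<open>(r, s, r, s)\<close> into its set \<open>A\<close> of odd coordinates and the signs on
  \<open>A\<close> and on its complement turns \<open>\<lambda>(v)\<close> into a sum over \<open>2 s\<close>-sets \<open>A\<close> of a unimodular factor
  times two central Krawtchouk values, which vanish at odd arguments. If \<open>v\<close> has \<open>2 k\<close> odd
  coordinates, the triangle inequality and Vandermonde's identity give
  \<open>\<bar>\<lambda>(v)\<bar> \<le> M (n/2 choose k) / (n choose 2 k)\<close> with \<open>M\<close> the degree of the graph, which is at most
  \<open>M / (n - 1)\<close> for \<open>0 < k < n/2\<close>; at type \<open>(0, 1, n - 2, 1)\<close> all summands are negative and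
  equality holds. For \<open>k = 0\<close> and \<open>k = n/2\<close> the eigenvalue is a multiple of the Krawtchouk polynomial
  of degree \<open>2 s\<close>. It is positive before the turning point of its three-term recurrence, and beyond it
  a saddle-point bound for the coefficients of \<open>(1 - z\<^sup>2)\<^sup>t (1 + z)\<^bsup>n - 2 t\<^esup>\<close> is strong enough.
\<close>

section \<open>Krawtchouk polynomials\<close>

text \<open>The value at \<open>t\<close> of the Krawtchouk polynomial of degree \<open>d\<close> on
  \<open>n\<close> points, given through its generating function: the recurrence then follows by
  differentiation, and bounds follow by evaluating a majorant at a positive point.\<close>

definition kraw :: "nat \<Rightarrow> nat \<Rightarrow> nat \<Rightarrow> real" where
  "kraw n t d = coeff ([:1, -1:] ^ t * [:1, 1:] ^ (n - t)) d"

text \<open>When the product is expanded, \<open>S\<close> records the factors from which the linear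
  term is taken.\<close>

lemma poly_prod_linear_coeff:
  fixes c :: "'a \<Rightarrow> 'b :: comm_ring_1"
  assumes "finite I"
  shows "coeff (\<Prod>i\<in>I. [:1, c i:]) d = (\<Sum>S | S \<subseteq> I \<and> card S = d. \<Prod>i\<in>S. c i)"
proof -
  have "(\<Prod>i\<in>I. [:1, c i:]) = (\<Prod>i\<in>I. monom (c i) 1 + 1)"
    by (intro prod.cong) (auto simp: monom_altdef one_pCons)
  also have "\<dots> = (\<Sum>S\<in>Pow I. (\<Prod>i\<in>S. monom (c i) 1))"
    using assms by (subst prod_add) auto
  also have "\<dots> = (\<Sum>S\<in>Pow I. monom (\<Prod>i\<in>S. c i) (card S))"
  proof (intro sum.cong refl)
    fix S assume "S \<in> Pow I"
    hence "finite S" using assms finite_subset by blast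
    thus "(\<Prod>i\<in>S. monom (c i) 1) = monom (\<Prod>i\<in>S. c i) (card S)"
      by (induction S rule: finite_induct) (auto simp: mult_monom)
  qed
  finally have "coeff (\<Prod>i\<in>I. [:1, c i:]) d
      = (\<Sum>S\<in>Pow I. if card S = d then \<Prod>i\<in>S. c i else 0)"
    by (simp add: coeff_sum)
  also have "\<dots> = (\<Sum>S | S \<subseteq> I \<and> card S = d. \<Prod>i\<in>S. c i)"
    using assms by (intro sum.mono_neutral_cong_right) auto
  finally show ?thesis .
qed

lemma prod_indicator_sign:
  assumes "finite S"
  shows "(\<Prod>i\<in>S. if i \<in> T then - 1 else 1 :: 'b :: comm_ring_1) = (- 1) ^ card (S \<inter> T)"
  using assms by (simp add: prod.If_cases Collect_mem_eq)

text \<open>Elements of \<open>T\<close> contribute the factor \<open>1 - z\<close>, the others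
  \<open>1 + z\<close>. This links character sums over subsets with the generating function.\<close>

lemma kraw_subsets:
  assumes I: "finite I" and T: "T \<subseteq> I"
  shows "(\<Sum>S | S \<subseteq> I \<and> card S = d. (- 1) ^ card (S \<inter> T)) = kraw (card I) (card T) d"
proof -
  have "(\<Sum>S | S \<subseteq> I \<and> card S = d. (- 1 :: real) ^ card (S \<inter> T)) =
      (\<Sum>S | S \<subseteq> I \<and> card S = d. \<Prod>i\<in>S. if i \<in> T then - 1 else 1)"
    using I by (intro sum.cong refl, subst prod_indicator_sign) (auto intro: finite_subset)
  also have "\<dots> = coeff (\<Prod>i\<in>I. [:1, if i \<in> T then - 1 else 1:]) d"
    by (rule poly_prod_linear_coeff[OF I, symmetric])
  also have "(\<Prod>i\<in>I. [:1, if i \<in> T then - 1 else 1 :: real:])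
      = (\<Prod>i\<in>T. [:1, -1:]) * (\<Prod>i\<in>I-T. [:1, 1:])"
    using assms by (subst prod.subset_diff[OF T I], subst mult.commute) (intro arg_cong2[of _ _ _ _ "(*)"] prod.cong; auto)
  also have "\<dots> = [:1, -1:] ^ card T * [:1, 1:] ^ (card I - card T)"
    using assms by (simp add: card_Diff_subset finite_subset)
  finally show ?thesis by (simp add: kraw_def)
qed

lemma kraw_0: "kraw n 0 d = real (n choose d)"
proof -
  have "kraw n 0 d = (\<Sum>S | S \<subseteq> {..<n} \<and> card S = d. 1)"
    using kraw_subsets[of "{..<n}" "{}" d] by simp
  also have "\<dots> = real (n choose d)"
    using n_subsets[of "{..<n}" d] by simp
  finally show ?thesis .
qed

text \<open>A set of even size meets \<open>{..<t}\<close> and \<open>{t..<n}\<close> in numbers of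
  equal parity, so both give it the same sign. Estimates are therefore needed only for
  \<open>2 * t <= n\<close>.\<close>

lemma kraw_complement:
  assumes "t \<le> n" "even d"
  shows "kraw n (n - t) d = kraw n t d"
proof -
  have "kraw n (n - t) d = (\<Sum>S | S \<subseteq> {..<n} \<and> card S = d. (- 1) ^ card (S \<inter> {t..<n}))"
    using kraw_subsets[of "{..<n}" "{t..<n}" d] by (simp add: subset_eq)
  also have "\<dots> = (\<Sum>S | S \<subseteq> {..<n} \<and> card S = d. (- 1) ^ card (S \<inter> {..<t}))"
  proof (intro sum.cong refl)
    fix S assume S: "S \<in> {S. S \<subseteq> {..<n} \<and> card S = d}"
    hence f: "finite S" using finite_subset by blast
    have "S = (S \<inter> {t..<n}) \<union> (S \<inter> {..<t})" using S by auto
    moreover have "card ((S \<inter> {t..<n}) \<union> (S \<inter> {..<t})) = card (S \<inter> {t..<n}) + card (S \<inter> {..<t})"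
      using f by (intro card_Un_disjoint) auto
    ultimately have "even (card (S \<inter> {t..<n}) + card (S \<inter> {..<t}))"
      using S assms(2) by simp
    hence "even (card (S \<inter> {t..<n})) = even (card (S \<inter> {..<t}))" by simp
    thus "(- 1 :: real) ^ card (S \<inter> {t..<n}) = (- 1) ^ card (S \<inter> {..<t})"
      by (simp add: minus_one_power_iff)
  qed
  also have "\<dots> = kraw n t d"
    using kraw_subsets[of "{..<n}" "{..<t}" d] assms by auto
  finally show ?thesis .
qed

text \<open>Both sides of the recurrence are coefficients of
  \<open>n p - 2 z p'\<close> with \<open>p = (1 - z)\<^sup>t (1 + z)\<^bsup>n - t\<^esup>\<close>.\<close>

lemma kraw_rec:
  assumes "t \<le> n"
  shows "real (n - t) * kraw n (Suc t) d + real t * kraw n (t - 1) d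
    = (real n - 2 * real d) * kraw n t d"
proof -
  define F :: "nat \<Rightarrow> nat \<Rightarrow> real poly" where "F a b = [:1, -1:] ^ a * [:1, 1:] ^ b" for a b
  obtain b where b: "n = t + b" using assms le_Suc_ex by blast
  define D where "D = Polynomial.smult (real n) (F t b) - Polynomial.smult 2 (pCons 0 (pderiv (F t b)))"
  have cD: "coeff D d = (real n - 2 * real d) * coeff (F t b) d"
    by (cases d) (auto simp: D_def coeff_pderiv algebra_simps)
  have pd: "pderiv ([:1, c:] ^ a) = Polynomial.smult (c * real a) ([:1, c:] ^ (a - 1))" for c :: real and a
    by (cases a) (simp_all add: pderiv_power_Suc pderiv_pCons mult.commute del: power_Suc)
  have pF: "poly (F a c) z = (1 - z) ^ a * (1 + z) ^ c" for a c and z :: real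
    by (simp add: F_def poly_power)
  have pF': "poly (pderiv (F a c)) z
      = real c * (1 - z) ^ a * (1 + z) ^ (c - 1) - real a * (1 - z) ^ (a - 1) * (1 + z) ^ c" for a c and z :: real
    by (simp add: F_def pderiv_mult pd poly_power)
  have "poly D = poly (Polynomial.smult (real b) (F (Suc t) (b - 1)) + Polynomial.smult (real t) (F (t - 1) (Suc b)))"
  proof
    fix z :: real
    \<comment> \<open>The truncated exponents \<open>t - 1\<close> and \<open>b - 1\<close> do no
      harm at 0, since the factor \<open>real t\<close> or \<open>real b\<close> in front vanishes
      there.\<close>
    have t: "real t * (1 - z) ^ t = real t * (1 - z) * (1 - z) ^ (t - 1)" by (cases t) auto
    have b': "real b * (1 + z) ^ b = real b * (1 + z) * (1 + z) ^ (b - 1)" by (cases b) auto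
    have "poly D z = (real t * (1 - z) ^ t) * (1 + z) ^ b + (1 - z) ^ t * (real b * (1 + z) ^ b)
        - 2 * z * (real b * (1 - z) ^ t * (1 + z) ^ (b - 1) - real t * (1 - z) ^ (t - 1) * (1 + z) ^ b)"
      by (simp add: D_def pF pF' b algebra_simps)
    also have "\<dots> = real b * (1 - z) * (1 - z) ^ t * (1 + z) ^ (b - 1)
        + real t * (1 + z) * (1 - z) ^ (t - 1) * (1 + z) ^ b"
      unfolding t b' by (simp add: algebra_simps)
    finally show "poly D z = poly (Polynomial.smult (real b) (F (Suc t) (b - 1)) + Polynomial.smult (real t) (F (t - 1) (Suc b))) z"
      by (simp add: pF)
  qed
  hence "D = Polynomial.smult (real b) (F (Suc t) (b - 1)) + Polynomial.smult (real t) (F (t - 1) (Suc b))"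
    by (simp only: poly_eq_poly_eq_iff)
  hence "coeff D d = real b * coeff (F (Suc t) (b - 1)) d + real t * coeff (F (t - 1) (Suc b)) d"
    by simp
  with cD show ?thesis
    by (cases t) (auto simp: kraw_def F_def b)
qed

section \<open>Positivity before the turning point\<close>

text \<open>With \<open>N = n - 2 d\<close>, the recurrence at \<open>t\<close> has the
  characteristic polynomial \<open>(n - t) x^2 - N x + t\<close>. As long as
  \<open>4 t (n + 1 - t) <= N^2\<close>, the ratio of consecutive values stays at or above
  \<open>N / (2 (n - t))\<close>, the mean of its roots, so no sign change occurs. Positivity at
  \<open>t\<close> uses this invariant at \<open>t - 1\<close>, which explains the shift in the last
  hypothesis.\<close>

lemma kraw_pos:
  assumes d: "2 * d < n" and t: "2 * t \<le> n"
    and c: "4 * (real t - 1) * (real n + 2 - real t) \<le> (real n - 2 * real d)\<^sup>2"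
  shows "kraw n t d > 0"
proof -
  define N where "N = real n - 2 * real d"
  have N: "N > 0" using d by (simp add: N_def)
  have "kraw n t d > 0 \<and> N * kraw n t d \<le> 2 * real (n - t) * kraw n (Suc t) d"
    if "2 * t < n" "4 * real t * (real n + 1 - real t) \<le> N\<^sup>2" for t
    using that
  proof (induction t)
    case 0
    have "kraw n 0 d > 0" using d by (simp add: kraw_0)
    moreover have "N * kraw n 0 d = real n * kraw n 1 d"
      using kraw_rec[of 0 n d] by (simp add: N_def)
    ultimately show ?case using N zero_less_mult_iff[of N "kraw n 0 d"] by auto
  next
    case (Suc t)
    \<comment> \<open>The product \<open>t (n + 1 - t)\<close> increases while
      \<open>2 * t < n\<close>, so the condition passes from \<open>Suc t\<close> down to
      \<open>t\<close>.\<close>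
    have "4 * real t * (real n + 1 - real t) \<le> 4 * real (Suc t) * (real n + 1 - real (Suc t))"
      using Suc.prems(1) by (simp add: algebra_simps)
    hence IH: "kraw n t d > 0" "N * kraw n t d \<le> 2 * real (n - t) * kraw n (Suc t) d"
      using Suc by auto
    have "0 < N * kraw n t d" using IH N by simp
    hence "0 < 2 * real (n - t) * kraw n (Suc t) d" using IH by linarith
    hence pos: "kraw n (Suc t) d > 0" by (auto simp: zero_less_mult_iff)
    have nt: "real (n - t) = real n - real t" using Suc.prems by simp
    \<comment> \<open>The invariant at \<open>t\<close> and the condition at \<open>Suc t\<close>
      show that the term subtracted in the recurrence takes away at most half of
      \<open>N * kraw n (Suc t) d\<close>.\<close>
    have "N * (2 * real (Suc t) * kraw n t d) = 2 * real (Suc t) * (N * kraw n t d)" by simp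
    also have "\<dots> \<le> 2 * real (Suc t) * (2 * real (n - t) * kraw n (Suc t) d)"
      using IH by (intro mult_left_mono) auto
    also have "\<dots> = (4 * real (Suc t) * (real n + 1 - real (Suc t))) * kraw n (Suc t) d"
      using nt by (simp add: algebra_simps)
    also have "\<dots> \<le> N\<^sup>2 * kraw n (Suc t) d"
      using Suc.prems pos by (intro mult_right_mono) auto
    finally have "N * (2 * real (Suc t) * kraw n t d) \<le> N * (N * kraw n (Suc t) d)"
      by (simp add: power2_eq_square mult.assoc)
    hence "2 * real (Suc t) * kraw n t d \<le> N * kraw n (Suc t) d" using N by simp
    moreover have "real (n - Suc t) * kraw n (Suc (Suc t)) d + real (Suc t) * kraw n t d
        = N * kraw n (Suc t) d"
      using kraw_rec[of "Suc t" n d] Suc.prems by (simp add: N_def)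
    ultimately have "N * kraw n (Suc t) d \<le> 2 * (real (n - Suc t) * kraw n (Suc (Suc t)) d)"
      by linarith
    thus ?case using pos by simp
  qed
  note * = this
  show ?thesis
  proof (cases t)
    case 0
    thus ?thesis using d by (simp add: kraw_0)
  next
    case (Suc u)
    have "kraw n u d > 0 \<and> N * kraw n u d \<le> 2 * real (n - u) * kraw n (Suc u) d"
      using c t Suc by (intro *) (auto simp: N_def algebra_simps)
    hence "0 < 2 * real (n - u) * kraw n (Suc u) d"
      using N by (meson less_le_trans mult_pos_pos)
    thus ?thesis using Suc by (auto simp: zero_less_mult_iff)
  qed
qed

section \<open>Coefficient bounds by positive majorants\<close>

text \<open>Coefficientwise majorization forces the coefficients of \<open>q\<close> to be
  nonnegative, so no cancellation occurs when \<open>q\<close> is evaluated at a point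
  \<open>z >= 0\<close>.\<close>

definition dominated :: "real poly \<Rightarrow> real poly \<Rightarrow> bool" where
  "dominated p q \<longleftrightarrow> (\<forall>i. \<bar>coeff p i\<bar> \<le> coeff q i)"

lemma dominated_mult:
  assumes "dominated p p'" "dominated q q'"
  shows "dominated (p * q) (p' * q')"
  unfolding dominated_def
proof
  fix i
  have "\<bar>coeff (p * q) i\<bar> \<le> (\<Sum>j\<le>i. \<bar>coeff p j * coeff q (i - j)\<bar>)"
    by (simp add: coeff_mult sum_abs)
  also have "\<dots> \<le> (\<Sum>j\<le>i. coeff p' j * coeff q' (i - j))"
    using assms unfolding dominated_def abs_mult
    by (intro sum_mono mult_mono) (auto intro: order_trans[OF abs_ge_zero])
  finally show "\<bar>coeff (p * q) i\<bar> \<le> coeff (p' * q') i" by (simp add: coeff_mult)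
qed

lemma dominated_power: "dominated p q \<Longrightarrow> dominated (p ^ k) (q ^ k)"
  by (induction k) (simp_all add: dominated_mult, simp add: dominated_def)

text \<open>A single term of a sum of nonnegative terms is at most the sum. Choosing
  \<open>z\<close> well turns this into the saddle-point bound.\<close>

lemma dominated_coeff_le:
  assumes "dominated p q" "z \<ge> 0"
  shows "\<bar>coeff p d\<bar> * z ^ d \<le> poly q z"
proof (cases "d \<le> degree q")
  case True
  have nn: "coeff q i \<ge> 0" for i
    using assms by (metis abs_ge_zero dominated_def order_trans)
  have "\<bar>coeff p d\<bar> * z ^ d \<le> coeff q d * z ^ d"
    using assms by (intro mult_right_mono) (auto simp: dominated_def)
  also have "\<dots> \<le> (\<Sum>i\<le>degree q. coeff q i * z ^ i)"
    using True nn assms by (intro member_le_sum) auto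
  also have "\<dots> = poly q z" by (simp add: poly_altdef)
  finally show ?thesis .
next
  case False
  have "coeff q d = 0" using False by (simp add: coeff_eq_0)
  moreover have "\<bar>coeff p d\<bar> \<le> coeff q d" using assms by (auto simp: dominated_def)
  ultimately have "coeff p d = 0" by simp
  moreover have "poly q z \<ge> 0"
    unfolding poly_altdef using assms
    by (intro sum_nonneg mult_nonneg_nonneg) (auto simp: dominated_def intro: order_trans[OF abs_ge_zero])
  ultimately show ?thesis by simp
qed

text \<open>Pairing each factor \<open>1 - z\<close> with a factor \<open>1 + z\<close> leaves \<open>1 - z\<^sup>2\<close>, whose coefficients
  are then replaced by their absolute values.\<close>

lemma kraw_le:
  assumes "2 * t \<le> n" "z \<ge> 0"
  shows "\<bar>kraw n t d\<bar> * z ^ d \<le> (1 + z\<^sup>2) ^ t * (1 + z) ^ (n - 2 * t)"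
proof -
  have "n - t = t + (n - 2 * t)" using assms by simp
  hence "[:1, -1 :: real:] ^ t * [:1, 1:] ^ (n - t) = ([:1, -1:] * [:1, 1:]) ^ t * [:1, 1:] ^ (n - 2 * t)"
    by (simp only: power_add power_mult_distrib mult.assoc)
  also have "[:1, -1 :: real:] * [:1, 1:] = [:1, 0, -1:]" by simp
  finally have k: "kraw n t d = coeff ([:1, 0, -1:] ^ t * [:1, 1:] ^ (n - 2 * t)) d"
    by (simp only: kraw_def)
  have "dominated ([:1, 0, -1:] ^ t * [:1, 1:] ^ (n - 2 * t))
      ([:1, 0, 1:] ^ t * [:1, 1:] ^ (n - 2 * t))"
    by (intro dominated_mult dominated_power)
      (auto simp: dominated_def coeff_pCons split: nat.split)
  from dominated_coeff_le[OF this assms(2), of d] show ?thesis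
    by (simp add: k poly_power power2_eq_square)
qed

section \<open>Krawtchouk values of middle degree\<close>

text \<open>In middle degree the right-hand side of the recurrence is zero, so values two steps
  apart are proportional. The chain of odd arguments starts with the value 0 at argument 1.\<close>

lemma kraw_central_odd:
  assumes "odd t" "t \<le> 2 * s"
  shows "kraw (2 * s) t s = 0"
proof -
  have "2 * m + 1 \<le> 2 * s \<Longrightarrow> kraw (2 * s) (2 * m + 1) s = 0" for m
  proof (induction m)
    case 0
    thus ?case using kraw_rec[of 0 "2 * s" s] by simp
  next
    case (Suc m)
    have "real (2 * s - (2 * m + 2)) * kraw (2 * s) (2 * m + 3) s = 0"
      using kraw_rec[of "2 * m + 2" "2 * s" s] Suc by (simp add: numeral_3_eq_3)
    thus ?case using Suc.prems by (simp add: numeral_3_eq_3)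
  qed
  thus ?thesis using assms by (auto elim: oddE)
qed

lemma choose_Suc_real:
  "real (Suc k) * real (n choose Suc k) = (real n - real k) * real (n choose k)"
proof (cases "k \<le> n")
  case True
  have "Suc k * (n choose Suc k) = (n - k) * (n choose k)"
    unfolding binomial_absorption binomial_absorb_comp ..
  hence "real (Suc k * (n choose Suc k)) = real ((n - k) * (n choose k))" by (rule arg_cong)
  thus ?thesis using True by (simp only: of_nat_mult of_nat_diff)
qed (simp add: binomial_eq_0)

text \<open>The same proportionality gives the ratio \<open>- (2 m + 1) / (2 s - 2 m - 1)\<close>
  between consecutive even arguments. The binomial factor on the left makes it match the ratio
  \<open>- (s - m) / (m + 1)\<close> on the right.\<close>

lemma kraw_central_even:
  assumes "m \<le> s"
  shows "kraw (2 * s) (2 * m) s * real (2 * s choose (2 * m))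
    = (- 1) ^ m * real (2 * s choose s) * real (s choose m)"
  using assms
proof (induction m)
  case 0
  thus ?case by (simp add: kraw_0)
next
  case (Suc m)
  define P where "P = kraw (2 * s) (2 * m) s"
  define P' where "P' = kraw (2 * s) (2 * Suc m) s"
  define c0 where "c0 = real (2 * s choose (2 * m))"
  define c1 where "c1 = real (2 * s choose (2 * m + 1))"
  define c2 where "c2 = real (2 * s choose (2 * m + 2))"
  \<comment> \<open>\<open>a\<close> and \<open>b\<close> are the two coefficients of the recurrence
    at argument \<open>2 * m + 1\<close>.\<close>
  define a where "a = 2 * real m + 1"
  define b where "b = real (2 * s) - a"
  have b0: "b > 0" and a0: "a > 0" using Suc.prems by (auto simp: b_def a_def)
  have IH: "P * c0 = (- 1) ^ m * real (2 * s choose s) * real (s choose m)"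
    using Suc unfolding P_def c0_def by simp
  have r: "b * P' = - a * P"
    using kraw_rec[of "2 * m + 1" "2 * s" s] Suc.prems
    by (simp add: P_def P'_def a_def b_def algebra_simps of_nat_diff)
  have e1: "a * c1 = (b + 1) * c0" using choose_Suc_real[of "2 * m" "2 * s"]
    by (simp add: a_def b_def c0_def c1_def add.commute)
  have e2: "(a + 1) * c2 = b * c1" using choose_Suc_real[of "2 * m + 1" "2 * s"]
    by (simp add: a_def b_def c1_def c2_def algebra_simps)
  have e3: "(a + 1) * real (s choose Suc m) = (b + 1) * real (s choose m)"
    using choose_Suc_real[of m s] by (simp add: a_def b_def algebra_simps)
  have "(a + 1) * (b * (P' * c2)) = (b * P') * ((a + 1) * c2)" by simp
  also have "\<dots> = - b * P * (a * c1)" unfolding r e2 by simp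
  also have "\<dots> = - b * (b + 1) * (P * c0)" unfolding e1 by simp
  also have "\<dots> = - b * (- 1) ^ m * real (2 * s choose s) * ((b + 1) * real (s choose m))"
    unfolding IH by simp
  also have "\<dots> = (a + 1) * (b * ((- 1) ^ Suc m * real (2 * s choose s) * real (s choose Suc m)))"
    unfolding e3[symmetric] by simp
  finally have "b * (P' * c2) = b * ((- 1) ^ Suc m * real (2 * s choose s) * real (s choose Suc m))"
    using a0 by (subst (asm) mult_cancel_left) simp
  hence "P' * c2 = (- 1) ^ Suc m * real (2 * s choose s) * real (s choose Suc m)"
    using b0 by (subst (asm) mult_cancel_left) simp
  thus ?case by (simp add: P'_def c2_def)
qed

section \<open>Lower bounds in even degree\<close>

text \<open>Reflection in \<open>n / 2\<close> brings \<open>t\<close> into the lower half, and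
  \<open>kraw_pos\<close> settles the arguments before the turning point. An upper bound on the
  absolute value is thus needed only beyond it.\<close>

lemma kraw_ge:
  assumes d: "even d" "2 * d < n" and t: "t \<le> n"
    and B: "B \<ge> 0" "\<And>t. 2 * t \<le> n \<Longrightarrow>
      (real n - 2 * real d)\<^sup>2 < 4 * (real t - 1) * (real n + 2 - real t) \<Longrightarrow> \<bar>kraw n t d\<bar> \<le> B"
  shows "kraw n t d \<ge> - B"
proof -
  have *: "kraw n t d \<ge> - B" if "2 * t \<le> n" for t
    using kraw_pos[OF d(2) that] B(2)[OF that] B(1) by fastforce
  show ?thesis
    using *[of t] *[of "n - t"] kraw_complement[OF t d(1)] t by (cases "2 * t \<le> n") auto
qed

text \<open>Beyond the turning point \<open>n - 2 t\<close> is of order at most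
  \<open>sqrt n\<close>, so the saddle-point bound is a constant times \<open>n ^ s\<close>. The
  binomial coefficient has order \<open>n ^ (2 * s)\<close>, and the gap \<open>n ^ s\<close> beats
  the denominator \<open>n - 1\<close> because \<open>s >= 2\<close>.\<close>

lemma kraw_ge_fixed_degree:
  assumes s: "s \<ge> 2"
  shows "\<exists>N. \<forall>n\<ge>N. \<forall>t\<le>n. kraw n t (2 * s) \<ge> - (real (n choose (2 * s)) / (real n - 1))"
proof -
  define d where "d = 2 * s"
  \<comment> \<open>\<open>K * n\<close> bounds the square of \<open>X = n - 2 t\<close> beyond the
    turning point, and \<open>E\<close> bounds the exponential \<open>exp (t z^2 + X z)\<close> at
    the chosen \<open>z\<close>. The two entries of \<open>N\<close> yield \<open>2 * d < n\<close>
    and \<open>E * d ^ d <= n\<close>.\<close>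
  define K where "K = 4 * real d + 2"
  define E where "E = exp (1 + sqrt K)"
  define N where "N = max (2 * d + 2) (nat \<lceil>E * real d ^ d\<rceil>)"
  have "kraw n t d \<ge> - (real (n choose d) / (real n - 1))" if n: "n \<ge> N" and tn: "t \<le> n" for n t
  proof (rule kraw_ge[OF _ _ tn])
    show "even d" "2 * d < n" using n by (auto simp: d_def N_def)
    have n2: "n \<ge> 2" using n by (auto simp: N_def)
    show "0 \<le> real (n choose d) / (real n - 1)" using n2 by simp
    fix t assume t: "2 * t \<le> n"
      and far: "(real n - 2 * real d)\<^sup>2 < 4 * (real t - 1) * (real n + 2 - real t)"
    define X where "X = real (n - 2 * t)"
    have X: "X = real n - 2 * real t" using t by (simp add: X_def)
    have "4 * (real t - 1) * (real n + 2 - real t) = (real n)\<^sup>2 - X\<^sup>2 + 2 * real n - 6 * X - 8"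
      by (simp add: X algebra_simps power2_eq_square)
    moreover have "(real n - 2 * real d)\<^sup>2 \<ge> (real n)\<^sup>2 - 4 * real d * real n"
      by (simp add: power2_eq_square algebra_simps)
    moreover have "X \<ge> 0" by (simp add: X_def)
    ultimately have "X\<^sup>2 \<le> K * real n" using far by (simp add: K_def algebra_simps)
    hence X_le: "X \<le> sqrt K * sqrt (real n)"
      by (metis real_le_rsqrt real_sqrt_mult)
    \<comment> \<open>At this \<open>z\<close> both terms of the exponent \<open>t z^2 + X z\<close>
      are bounded independently of \<open>n\<close>.\<close>
    define z where "z = 1 / sqrt (real n)"
    have z: "z > 0" "z\<^sup>2 = 1 / real n" using n2 by (auto simp: z_def power_divide)
    have "\<bar>kraw n t d\<bar> * z ^ d \<le> (1 + z\<^sup>2) ^ t * (1 + z) ^ (n - 2 * t)"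
      using z by (intro kraw_le[OF t]) auto
    also have "\<dots> \<le> exp (z\<^sup>2) ^ t * exp z ^ (n - 2 * t)"
      using z by (intro mult_mono power_mono) (auto simp: exp_ge_add_one_self)
    also have "\<dots> = exp (real t * z\<^sup>2 + X * z)"
      by (simp add: exp_add X_def exp_of_nat_mult)
    also have "\<dots> \<le> E"
    proof -
      have "real t * z\<^sup>2 \<le> 1" unfolding z(2) using n2 t by simp
      moreover have "X * z \<le> sqrt K" using X_le n2 by (simp add: z_def field_simps)
      ultimately show ?thesis by (simp add: E_def)
    qed
    finally have "\<bar>kraw n t d\<bar> * z ^ d \<le> E" .
    moreover have "z ^ d = 1 / real n ^ s"
      unfolding d_def power_mult z by (simp add: power_divide)
    ultimately have le: "\<bar>kraw n t d\<bar> \<le> E * real n ^ s" using n2 by (simp add: field_simps)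
    have "E * real d ^ d \<le> real n" using n by (simp add: N_def nat_ceiling_le_eq)
    \<comment> \<open>This is where \<open>s >= 2\<close> enters: \<open>s - 1\<close> is
      positive.\<close>
    also have "\<dots> \<le> real n ^ (s - 1)"
      using s n2 by (intro self_le_power) auto
    finally have "E * real d ^ d * real n ^ (s + 1) \<le> real n ^ (s - 1) * real n ^ (s + 1)"
      by (intro mult_right_mono) auto
    also have "\<dots> = real n ^ (s - 1 + (s + 1))" by (simp only: power_add)
    also have "s - 1 + (s + 1) = d" using s by (simp add: d_def)
    finally have "E * real n ^ (s + 1) \<le> (real n / real d) ^ d"
      using s by (simp add: power_divide field_simps d_def)
    also have "\<dots> \<le> real (n choose d)"
      using n by (intro binomial_ge_n_over_k_pow_k) (auto simp: N_def)
    finally have "E * real n ^ s * real n \<le> real (n choose d)" by (simp add: mult_ac)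
    moreover have "E * real n ^ s * (real n - 1) \<le> E * real n ^ s * real n"
      by (intro mult_left_mono) (auto simp: E_def)
    ultimately have "E * real n ^ s * (real n - 1) \<le> real (n choose d)" by linarith
    hence "E * real n ^ s \<le> real (n choose d) / (real n - 1)" using n2 by (simp add: field_simps)
    with le show "\<bar>kraw n t d\<bar> \<le> real (n choose d) / (real n - 1)" by simp
  qed
  thus ?thesis unfolding d_def by blast
qed

text \<open>Up to normalization these are the weights of the binomial distribution with success
  probability \<open>d / n\<close>, whose mode is its mean \<open>d\<close>. Since
  \<open>(n - d) z = d\<close>, the ratio \<open>(n - k) z / (k + 1)\<close> of consecutive terms is
  at least 1 for \<open>k < d\<close> and at most 1 from \<open>d\<close> on.\<close>

lemma binomial_term_le_mode:
  assumes d: "d < n" and k: "k \<le> n" and z: "z = real d / real (n - d)"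
  shows "real (n choose k) * z ^ k \<le> real (n choose d) * z ^ d"
proof -
  define g where "g k = real (n choose k) * z ^ k" for k
  have z0: "z \<ge> 0" and zd: "(real n - real d) * z = real d" using d z by (auto simp: of_nat_diff)
  have g0: "g k \<ge> 0" for k using z0 by (simp add: g_def)
  have step: "real (Suc k) * g (Suc k) = ((real n - real k) * z) * g k" for k
    using choose_Suc_real[of k n] by (simp add: g_def)
  have down: "g (Suc k) \<le> g k" if "d \<le> k" for k
  proof -
    have "(real n - real k) * z \<le> (real n - real d) * z" using that z0 by (intro mult_right_mono) auto
    hence "((real n - real k) * z) * g k \<le> real (Suc k) * g k"
      using that zd g0 by (intro mult_right_mono) auto
    hence "real (Suc k) * g (Suc k) \<le> real (Suc k) * g k" by (simp only: step)
    thus ?thesis by (simp del: of_nat_Suc)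
  qed
  have up: "g k \<le> g (Suc k)" if "k < d" for k
  proof -
    have "(real n - real d) * z \<le> (real n - real k) * z" using that z0 by (intro mult_right_mono) auto
    hence "real (Suc k) * g k \<le> ((real n - real k) * z) * g k"
      using that zd g0 by (intro mult_right_mono) auto
    hence "real (Suc k) * g k \<le> real (Suc k) * g (Suc k)" by (simp only: step)
    thus ?thesis by (simp del: of_nat_Suc)
  qed
  have "g k \<le> g d"
  proof (cases "k \<le> d")
    case True
    thus ?thesis by (induction rule: inc_induct) (auto intro: order_trans[OF up])
  next
    case False
    hence "d \<le> k" by simp
    thus ?thesis by (induction rule: dec_induct) (auto intro: order_trans[OF down])
  qed
  thus ?thesis by (simp add: g_def)
qed

text \<open>At \<open>z = a / (1 - a)\<close> the majorant is \<open>(1 + z) ^ n\<close> times one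
  factor \<open>a^2 + (1 - a)^2\<close> for each of the \<open>t\<close> pairs. Expanding
  \<open>(1 + z) ^ n\<close> gives \<open>n + 1\<close> terms, the largest of which is the one with
  index \<open>d\<close>, so \<open>z ^ d\<close> cancels at the cost of a factor
  \<open>n + 1\<close>.\<close>

lemma kraw_le_geometric:
  assumes d: "0 < d" "d < n" and t: "2 * t \<le> n" and a: "real d = a * real n"
  shows "\<bar>kraw n t d\<bar> \<le> (real n + 1) * (a\<^sup>2 + (1 - a)\<^sup>2) ^ t * real (n choose d)"
proof -
  define z where "z = real d / real (n - d)"
  have z0: "z > 0" using d by (simp add: z_def)
  have "z = a * real n / ((1 - a) * real n)"
    using d a by (simp add: z_def of_nat_diff algebra_simps)
  hence z: "z = a / (1 - a)" using d by simp
  have "a * real n < 1 * real n" using a d by linarith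
  hence a1: "a < 1" by (rule mult_right_less_imp_less) simp
  have sq: "1 + z\<^sup>2 = (a\<^sup>2 + (1 - a)\<^sup>2) * (1 + z)\<^sup>2"
  proof -
    have "1 + z = 1 / (1 - a)" using a1 by (simp add: z field_simps)
    moreover have "1 + z\<^sup>2 = (a\<^sup>2 + (1 - a)\<^sup>2) / (1 - a)\<^sup>2"
      using a1 by (simp add: z power_divide add_divide_distrib)
    ultimately show ?thesis by (simp add: power_divide)
  qed
  have "\<bar>kraw n t d\<bar> * z ^ d \<le> (1 + z\<^sup>2) ^ t * (1 + z) ^ (n - 2 * t)"
    using z0 by (intro kraw_le[OF t]) auto
  also have "\<dots> = (a\<^sup>2 + (1 - a)\<^sup>2) ^ t * ((1 + z) ^ (2 * t) * (1 + z) ^ (n - 2 * t))"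
    by (simp add: sq power_mult_distrib power_mult)
  also have "(1 + z) ^ (2 * t) * (1 + z) ^ (n - 2 * t) = (1 + z) ^ n"
    using t by (simp flip: power_add)
  also have "(1 + z) ^ n = (\<Sum>k\<le>n. real (n choose k) * z ^ k)"
    using binomial_ring[of z 1 n] by (simp add: add.commute)
  also have "\<dots> \<le> (\<Sum>k\<le>n. real (n choose d) * z ^ d)"
    using d by (intro sum_mono binomial_term_le_mode) (auto simp: z_def)
  also have "\<dots> = (real n + 1) * real (n choose d) * z ^ d" by simp
  finally have "\<bar>kraw n t d\<bar> * z ^ d
      \<le> (a\<^sup>2 + (1 - a)\<^sup>2) ^ t * ((real n + 1) * real (n choose d) * z ^ d)"
    by (simp add: mult_left_mono)
  hence "\<bar>kraw n t d\<bar> * z ^ d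
      \<le> ((real n + 1) * (a\<^sup>2 + (1 - a)\<^sup>2) ^ t * real (n choose d)) * z ^ d"
    by (simp add: mult_ac)
  thus ?thesis using z0 by simp
qed

text \<open>Beyond the turning point \<open>t\<close> is at least a positive multiple of
  \<open>n\<close>, so the geometric factor decays exponentially in \<open>n\<close> and absorbs the
  polynomial factor \<open>(n + 1) (n - 1)\<close>.\<close>

lemma kraw_ge_linear_degree:
  fixes a :: real
  assumes a: "0 < a" "a < 1 / 2"
  shows "\<exists>N. \<forall>n d t. n \<ge> N \<and> even d \<and> real d = a * real n \<and> t \<le> n \<longrightarrow>
    kraw n t d \<ge> - (real (n choose d) / (real n - 1))"
proof -
  \<comment> \<open>The constant is chosen so that \<open>(n - 2 d)^2 = 4 c n^2\<close>; arguments
    beyond the turning point then satisfy \<open>c n <= t\<close>.\<close>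
  define c where "c = (1 - 2 * a)\<^sup>2 / 4"
  define b where "b = a\<^sup>2 + (1 - a)\<^sup>2"
  have c: "c > 0" using a by (simp add: c_def)
  have "b = 1 - 2 * (a * (1 - a))" by (simp add: b_def power2_eq_square algebra_simps)
  moreover have "a * (1 - a) > 0" using a by simp
  moreover have "b > 0" using a by (auto simp: b_def intro!: add_pos_pos)
  ultimately have b: "0 < b" "b < 1" by auto
  \<comment> \<open>Decay rate: \<open>b powr (c * n)\<close> equals
    \<open>exp (- L n)\<close>.\<close>
  define L where "L = - (c * ln b)"
  have "L > 0" using b c by (simp add: L_def mult_less_0_iff)
  hence "((\<lambda>n. (real n + 1) * (real n - 1) * exp (- (L * real n))) \<longlongrightarrow> 0) sequentially"
    by real_asymp
  also have "(\<lambda>n. exp (- (L * real n))) = (\<lambda>n. b powr (c * real n))"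
    using b by (simp add: L_def powr_def mult_ac)
  finally have "((\<lambda>n. (real n + 1) * (real n - 1) * b powr (c * real n)) \<longlongrightarrow> 0) sequentially" .
  hence "eventually (\<lambda>n. (real n + 1) * (real n - 1) * b powr (c * real n) < 1) sequentially"
    by (rule order_tendstoD) simp
  then obtain N where N: "\<And>n. n \<ge> N \<Longrightarrow> (real n + 1) * (real n - 1) * b powr (c * real n) < 1"
    by (auto simp: eventually_sequentially)
  have "kraw n t d \<ge> - (real (n choose d) / (real n - 1))"
    if n: "n \<ge> max N 2" and d: "even d" "real d = a * real n" and tn: "t \<le> n" for n d t
  proof (rule kraw_ge[OF d(1) _ tn])
    have n2: "n \<ge> 2" using n by simp
    have "2 * a * real n < 1 * real n" using a n2 by (intro mult_strict_right_mono) auto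
    hence "real (2 * d) < real n" using d(2) by linarith
    thus dn: "2 * d < n" by (simp only: of_nat_less_iff)
    have "real d > 0" unfolding d using a n2 by simp
    hence d0: "d > 0" by simp
    show "0 \<le> real (n choose d) / (real n - 1)" using n2 by simp
    fix t assume t: "2 * t \<le> n"
      and far: "(real n - 2 * real d)\<^sup>2 < 4 * (real t - 1) * (real n + 2 - real t)"
    have "(real n - 2 * real d)\<^sup>2 = 4 * c * real n * real n"
      unfolding d c_def by (simp add: power2_eq_square algebra_simps)
    \<comment> \<open>Completing the square removes the shifts by 1 and 2 from the turning-point
      condition.\<close>
    moreover have "real t * real n - (real t - 1) * (real n + 2 - real t)
        = (real t - 3 / 2)\<^sup>2 + (real n - 1 / 4)"
      by (simp add: power2_eq_square algebra_simps)
    hence "(real t - 1) * (real n + 2 - real t) \<le> real t * real n"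
      using n2 zero_le_power2[of "real t - 3 / 2"] numeral_le_real_of_nat_iff[of "num.Bit0 num.One" n]
      by linarith
    ultimately have "(c * real n) * real n \<le> real t * real n" using far by linarith
    hence ct: "c * real n \<le> real t" using n2 by simp
    have "b ^ t = b powr real t" using b by (simp add: powr_realpow)
    also have "\<dots> \<le> b powr (c * real n)" using ct b by (intro powr_mono') auto
    finally have "(real n + 1) * (real n - 1) * b ^ t \<le> (real n + 1) * (real n - 1) * b powr (c * real n)"
      using n2 by (intro mult_left_mono) auto
    also have "\<dots> \<le> 1" using N[of n] n by simp
    finally have "((real n + 1) * b ^ t) * (real n - 1) \<le> 1" by (simp add: mult_ac)
    hence "(real n + 1) * b ^ t \<le> 1 / (real n - 1)" using n2 by (simp add: pos_le_divide_eq)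
    hence "(real n + 1) * b ^ t * real (n choose d) \<le> 1 / (real n - 1) * real (n choose d)"
      by (intro mult_right_mono) auto
    moreover have "\<bar>kraw n t d\<bar> \<le> (real n + 1) * b ^ t * real (n choose d)"
      unfolding b_def using dn d0 t d by (intro kraw_le_geometric) auto
    ultimately show "\<bar>kraw n t d\<bar> \<le> real (n choose d) / (real n - 1)" by simp
  qed
  thus ?thesis by blast
qed

section \<open>Sums over subsets of given size\<close>

text \<open>A subset \<open>A\<close> is determined by its parts inside and outside
  \<open>U\<close>, which can be chosen independently once the size \<open>j\<close> of the inner
  part is fixed.\<close>

lemma sum_subsets_card_inter:
  fixes F :: "nat \<Rightarrow> real"
  assumes I: "finite I" and U: "U \<subseteq> I"
  shows "(\<Sum>A | A \<subseteq> I \<and> card A = d. F (card (A \<inter> U))) =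
    (\<Sum>j\<le>d. real (card U choose j) * real ((card I - card U) choose (d - j)) * F j)"
proof -
  define X where "X j = {B. B \<subseteq> U \<and> card B = j} \<times> {C. C \<subseteq> I - U \<and> card C = d - j}" for j
  have fin: "finite U" "finite (I - U)" using I U finite_subset by auto
  have cX: "card (X j) = (card U choose j) * ((card I - card U) choose (d - j))" for j
    using fin U by (simp add: X_def card_cartesian_product n_subsets card_Diff_subset)
  have "(\<Sum>A | A \<subseteq> I \<and> card A = d. F (card (A \<inter> U))) = (\<Sum>(j, p)\<in>Sigma {..d} X. F j)"
  proof (rule sum.reindex_bij_witness[where i = "\<lambda>(j, B, C). B \<union> C" and j = "\<lambda>A. (card (A \<inter> U), A \<inter> U, A - U)"])
    fix A assume "A \<in> {A. A \<subseteq> I \<and> card A = d}"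
    hence A: "A \<subseteq> I" "card A = d" "finite A" using I finite_subset by auto
    hence "card (A \<inter> U) \<le> d" using card_mono[of A "A \<inter> U"] by auto
    moreover have "card (A - U) = d - card (A \<inter> U)"
      using A by (simp add: card_Diff_subset_Int)
    ultimately show "(card (A \<inter> U), A \<inter> U, A - U) \<in> Sigma {..d} X"
      using A by (auto simp: X_def)
  next
    fix y assume "y \<in> Sigma {..d} X"
    then obtain j B C where y: "y = (j, B, C)" "j \<le> d" "B \<subseteq> U" "card B = j" "C \<subseteq> I - U" "card C = d - j"
      by (auto simp: X_def)
    have "finite B" "finite C" using finite_subset[OF y(3)] finite_subset[OF y(5)] fin by auto
    hence "card (B \<union> C) = d" using y by (subst card_Un_disjoint) auto
    thus "(case y of (j, B, C) \<Rightarrow> B \<union> C) \<in> {A. A \<subseteq> I \<and> card A = d}"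
      using y U by auto
    have "(B \<union> C) \<inter> U = B" "(B \<union> C) - U = C" using y by auto
    thus "(card ((case y of (j, B, C) \<Rightarrow> B \<union> C) \<inter> U), (case y of (j, B, C) \<Rightarrow> B \<union> C) \<inter> U,
        (case y of (j, B, C) \<Rightarrow> B \<union> C) - U) = y"
      using y by simp
  qed auto
  also have "\<dots> = (\<Sum>j\<le>d. \<Sum>p\<in>X j. F j)"
  proof (subst sum.Sigma)
    show "\<forall>x\<in>{..d}. finite (X x)" using fin by (auto simp: X_def)
  qed auto
  finally show ?thesis by (simp add: cX)
qed

section \<open>Binomial identities and inequalities\<close>

text \<open>Both sides count ordered pairs of disjoint subsets of sizes \<open>p\<close> and
  \<open>q\<close>.\<close>

lemma choose_choose_commute:
  assumes "p \<le> n" "q \<le> n"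
  shows "(n choose p) * ((n - p) choose q) = (n choose q) * ((n - q) choose p)"
proof (cases "p + q \<le> n")
  case True
  have "(n choose (p + q)) * ((p + q) choose p) = (n choose p) * ((n - p) choose q)"
    using choose_mult[of p "p + q" n] True by simp
  moreover have "(n choose (p + q)) * ((p + q) choose q) = (n choose q) * ((n - q) choose p)"
    using choose_mult[of q "p + q" n] True by simp
  moreover have "(p + q) choose p = (p + q) choose q"
    using binomial_symmetric[of p "p + q"] by simp
  ultimately show ?thesis by simp
next
  case False
  hence "n - p < q" "n - q < p" using assms by auto
  thus ?thesis by (simp add: binomial_eq_0)
qed

text \<open>Both sides count pairs of subsets of sizes \<open>a\<close> and \<open>b\<close> with
  exactly \<open>i\<close> common elements. It serves to exchange the roles of the summation set
  \<open>A\<close> and the fixed set \<open>U\<close>.\<close>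

lemma hypergeometric_commute:
  assumes "i \<le> a" "i \<le> b" "a \<le> n" "b \<le> n"
  shows "(n choose a) * (a choose i) * ((n - a) choose (b - i))
    = (n choose b) * (b choose i) * ((n - b) choose (a - i))"
proof -
  have "(n choose a) * (a choose i) * ((n - a) choose (b - i))
      = (n choose i) * (((n - i) choose (a - i)) * (((n - i) - (a - i)) choose (b - i)))"
    using choose_mult[of i a n] assms by simp
  also have "\<dots> = (n choose i) * (((n - i) choose (b - i)) * (((n - i) - (b - i)) choose (a - i)))"
    using assms by (subst choose_choose_commute) auto
  also have "\<dots> = (n choose b) * (b choose i) * ((n - b) choose (a - i))"
    using choose_mult[of i b n] assms by simp
  finally show ?thesis .
qed

text \<open>There is equality at \<open>k = 1\<close> and at \<open>k = h - 1\<close>. In between,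
  Pascal's rule is applied once to \<open>h choose k\<close> and twice to the doubled binomial; the
  two matching terms come from induction, and the remaining one is the inequality
  \<open>V\<close>.\<close>

lemma choose_double_ge:
  assumes "1 \<le> k" "k < h"
  shows "(2 * h - 1) * (h choose k) \<le> (2 * h) choose (2 * k)"
  using assms
proof (induction h arbitrary: k)
  case (Suc h)
  have two: "(2 * Suc h - 1) * Suc h = (2 * Suc h) choose 2"
    by (simp add: choose_two algebra_simps)
  consider "k = 1" | "k = h" | "2 \<le> k" "k < h" using Suc.prems by linarith
  thus ?case
  proof cases
    case 1
    thus ?thesis using two by simp
  next
    case 2
    have "2 * Suc h choose 2 * h = 2 * Suc h choose 2"
      using binomial_symmetric[of "2 * h" "2 * Suc h"] by simp
    moreover have "Suc h choose h = Suc h" by simp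
    ultimately show ?thesis using 2 two by simp
  next
    case 3
    then obtain l where l: "k = Suc l" "1 \<le> l" by (cases k) auto
    have IH1: "(2 * h - 1) * (h choose Suc l) \<le> (2 * h) choose (2 * Suc l)"
      and IH2: "(2 * h - 1) * (h choose l) \<le> (2 * h) choose (2 * l)"
      using Suc.IH[of "Suc l"] Suc.IH[of l] 3 l by auto
    \<comment> \<open>A single term of Vandermonde's sum for the splitting
      \<open>2 h = (h + 1) + (h - 1)\<close>.\<close>
    have "(Suc h choose Suc l) * ((h - 1) choose l)
        \<le> (\<Sum>j\<le>2 * l + 1. (Suc h choose j) * ((h - 1) choose (2 * l + 1 - j)))"
      using member_le_sum[of "Suc l" "{..2 * l + 1}" "\<lambda>j. (Suc h choose j) * ((h - 1) choose (2 * l + 1 - j))"]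
      by auto
    also have "\<dots> = (2 * h) choose (2 * l + 1)"
      using vandermonde[of "Suc h" "h - 1" "2 * l + 1"] 3 by (simp add: mult_2)
    finally have "(Suc h choose Suc l) * ((h - 1) choose l) \<le> (2 * h) choose (2 * l + 1)" .
    moreover have "(h - 1) choose l \<ge> 1" using 3 l by (simp add: Suc_leI)
    ultimately have V: "Suc h choose Suc l \<le> (2 * h) choose (2 * l + 1)"
      using mult_le_mono2[of 1 "(h - 1) choose l" "Suc h choose Suc l"] by linarith
    define c where "c = 2 * h - 1"
    have "2 * Suc h - 1 = c + 2" using 3 by (simp add: c_def)
    hence "(2 * Suc h - 1) * (Suc h choose Suc l)
        = c * (h choose Suc l) + c * (h choose l) + 2 * (Suc h choose Suc l)"
      by (simp add: algebra_simps)
    also have "\<dots> \<le> ((2 * h) choose (2 * Suc l)) + ((2 * h) choose (2 * l)) + 2 * ((2 * h) choose (2 * l + 1))"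
      using IH1 IH2 V by (simp only: c_def)
    also have "\<dots> = (2 * Suc h) choose (2 * Suc l)"
      by simp
    finally show ?thesis using l by simp
  qed
qed simp

lemma sum_even_terms:
  fixes g :: "nat \<Rightarrow> 'a :: comm_monoid_add"
  assumes "\<And>j. j \<le> 2 * s \<Longrightarrow> odd j \<Longrightarrow> g j = 0"
  shows "(\<Sum>j\<le>2 * s. g j) = (\<Sum>m\<le>s. g (2 * m))"
  using assms by (induction s) auto

text \<open>Only even intersection sizes \<open>2 m\<close> contribute. Exchanging \<open>A\<close>
  and \<open>U\<close> in the hypergeometric weight produces exactly the binomials that multiply the
  two Krawtchouk values in \<open>kraw_central_even\<close>. What remains is
  \<open>(s choose m) * (r choose (k - m))\<close>, which Vandermonde's identity sums.\<close>

lemma sum_kraw_central: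
  assumes n: "n = 2 * (r + s)" and k: "2 * k \<le> n"
    and I: "finite I" "card I = n" and U: "U \<subseteq> I" "card U = 2 * k"
  shows "(\<Sum>A | A \<subseteq> I \<and> card A = 2 * s.
        \<bar>kraw (2 * s) (card (A \<inter> U)) s * kraw (2 * r) (card ((I - A) \<inter> U)) r\<bar>) * real (n choose (2 * k))
    = real (n choose (2 * s)) * real (2 * s choose s) * real (2 * r choose r) * real ((r + s) choose k)"
proof -
  define F where "F j = \<bar>kraw (2 * s) j s * kraw (2 * r) (2 * k - j) r\<bar>" for j
  define G where "G j = real (2 * k choose j) * real ((n - 2 * k) choose (2 * s - j)) * F j" for j
  \<comment> \<open>For \<open>m > k\<close> the truncated difference \<open>k - m\<close> would
    leave the factor \<open>r choose 0 = 1\<close>, so these terms are set to 0 explicitly.\<close>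
  define T where "T m = (if m \<le> k then (s choose m) * (r choose (k - m)) else 0)" for m
  define M where "M = real (n choose (2 * s)) * real (2 * s choose s) * real (2 * r choose r)"
  have "(\<Sum>A | A \<subseteq> I \<and> card A = 2 * s.
        \<bar>kraw (2 * s) (card (A \<inter> U)) s * kraw (2 * r) (card ((I - A) \<inter> U)) r\<bar>)
      = (\<Sum>A | A \<subseteq> I \<and> card A = 2 * s. F (card (A \<inter> U)))"
  proof (intro sum.cong refl)
    fix A assume "A \<in> {A. A \<subseteq> I \<and> card A = 2 * s}"
    have "(I - A) \<inter> U = U - A \<inter> U" using U by auto
    moreover have "finite U" using U I finite_subset by auto
    ultimately have "card ((I - A) \<inter> U) = 2 * k - card (A \<inter> U)"
      using U by (simp add: card_Diff_subset)
    thus "\<bar>kraw (2 * s) (card (A \<inter> U)) s * kraw (2 * r) (card ((I - A) \<inter> U)) r\<bar> = F (card (A \<inter> U))"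
      by (simp add: F_def)
  qed
  also have "\<dots> = (\<Sum>j\<le>2 * s. G j)"
    by (subst sum_subsets_card_inter[OF I(1) U(1)]) (simp add: G_def I U)
  also have "\<dots> = (\<Sum>m\<le>s. G (2 * m))"
    by (intro sum_even_terms) (simp add: G_def F_def kraw_central_odd)
  finally have "(\<Sum>A | A \<subseteq> I \<and> card A = 2 * s.
        \<bar>kraw (2 * s) (card (A \<inter> U)) s * kraw (2 * r) (card ((I - A) \<inter> U)) r\<bar>) * real (n choose (2 * k))
      = (\<Sum>m\<le>s. G (2 * m) * real (n choose (2 * k)))"
    by (simp add: sum_distrib_right)
  also have "\<dots> = (\<Sum>m\<le>s. M * real (T m))"
  proof (intro sum.cong refl)
    fix m assume "m \<in> {..s}"
    hence m: "m \<le> s" by simp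
    consider "m > k" | "m \<le> k" "k - m > r" | "m \<le> k" "k - m \<le> r" by linarith
    thus "G (2 * m) * real (n choose (2 * k)) = M * real (T m)"
    proof cases
      case 1
      thus ?thesis by (simp add: G_def T_def binomial_eq_0)
    next
      case 2
      \<comment> \<open>Here the complement of \<open>A\<close> would have to contain more than
        \<open>2 r\<close> elements of \<open>U\<close>, so the weight vanishes.\<close>
      hence "r + m < k" by simp
      moreover from this have "m < s" using n k by auto
      ultimately have "n - 2 * k < 2 * s - 2 * m" using n k by auto
      hence "(n - 2 * k) choose (2 * s - 2 * m) = 0" by (rule binomial_eq_0)
      with 2 show ?thesis by (simp add: G_def T_def binomial_eq_0)
    next
      case 3
      have "(n choose (2 * k)) * (2 * k choose 2 * m) * ((n - 2 * k) choose (2 * s - 2 * m))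
          = (n choose (2 * s)) * (2 * s choose 2 * m) * ((n - 2 * s) choose (2 * k - 2 * m))"
        using 3 m k n by (intro hypergeometric_commute) auto
      also have "n - 2 * s = 2 * r" using n by simp
      finally have eq: "real (n choose (2 * k)) * real (2 * k choose 2 * m) * real ((n - 2 * k) choose (2 * s - 2 * m))
          = real (n choose (2 * s)) * real (2 * s choose 2 * m) * real (2 * r choose (2 * k - 2 * m))"
        by (simp only: of_nat_mult[symmetric])
      have dm: "2 * k - 2 * m = 2 * (k - m)" by simp
      have "G (2 * m) * real (n choose (2 * k)) =
          (real (n choose (2 * k)) * real (2 * k choose 2 * m) * real ((n - 2 * k) choose (2 * s - 2 * m)))
          * (\<bar>kraw (2 * s) (2 * m) s\<bar> * \<bar>kraw (2 * r) (2 * k - 2 * m) r\<bar>)"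
        by (simp only: G_def F_def abs_mult mult_ac)
      also have "\<dots> = real (n choose (2 * s)) *
          (\<bar>kraw (2 * s) (2 * m) s\<bar> * real (2 * s choose 2 * m)) *
          (\<bar>kraw (2 * r) (2 * (k - m)) r\<bar> * real (2 * r choose (2 * (k - m))))"
        unfolding eq dm by (simp only: mult_ac)
      finally have "G (2 * m) * real (n choose (2 * k)) = real (n choose (2 * s)) *
          (\<bar>kraw (2 * s) (2 * m) s\<bar> * real (2 * s choose 2 * m)) *
          (\<bar>kraw (2 * r) (2 * (k - m)) r\<bar> * real (2 * r choose (2 * (k - m))))" .
      moreover have "\<bar>kraw (2 * s) (2 * m) s\<bar> * real (2 * s choose 2 * m) = real (2 * s choose s) * real (s choose m)"
        using arg_cong[OF kraw_central_even[OF m], of abs] by (simp add: abs_mult power_abs)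
      moreover have "\<bar>kraw (2 * r) (2 * (k - m)) r\<bar> * real (2 * r choose (2 * (k - m)))
          = real (2 * r choose r) * real (r choose (k - m))"
        using arg_cong[OF kraw_central_even[OF 3(2)], of abs] by (simp add: abs_mult power_abs)
      ultimately show ?thesis using 3 by (simp add: T_def M_def mult_ac)
    qed
  qed
  also have "\<dots> = M * real (\<Sum>m\<le>s. T m)" by (simp add: sum_distrib_left)
  also have "(\<Sum>m\<le>s. T m) = (\<Sum>m\<le>max s k. T m)"
    by (intro sum.mono_neutral_left) (auto simp: T_def binomial_eq_0)
  also have "\<dots> = (\<Sum>m\<le>k. T m)"
    by (intro sum.mono_neutral_right) (auto simp: T_def)
  also have "\<dots> = (s + r) choose k" by (simp add: T_def vandermonde)
  finally show ?thesis by (simp add: M_def add.commute)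
qed

section \<open>Character sums\<close>

lemma zeta4_pow_simps [simp]:
  "zeta4_pow 0 = 1" "zeta4_pow 1 = \<i>" "zeta4_pow 2 = - 1" "zeta4_pow 3 = - \<i>"
  using zeta4_pow_of_nat[of 0] zeta4_pow_of_nat[of 1] zeta4_pow_of_nat[of 2] zeta4_pow_of_nat[of 3]
  by (auto simp: power3_eq_cube)

lemma Z4_of_nat: obtains k where "(x :: 4) = of_nat k"
  using Z4_cases[of x] by (metis of_nat_0 of_nat_1 of_nat_numeral)

lemma zeta4_pow_add: "zeta4_pow (x + y) = zeta4_pow x * zeta4_pow y"
proof -
  obtain j k where "x = of_nat j" "y = of_nat k" using Z4_of_nat by metis
  thus ?thesis by (simp add: zeta4_pow_of_nat power_add flip: of_nat_add)
qed

lemma zeta4_pow_sum: "zeta4_pow (\<Sum>i\<in>A. f i) = (\<Prod>i\<in>A. zeta4_pow (f i))"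
  by (induction A rule: infinite_finite_induct) (auto simp: zeta4_pow_add)

lemma norm_zeta4_pow [simp]: "norm (zeta4_pow x) = 1"
  using Z4_cases[of x] by auto

lemma zeta4_pow_double: "zeta4_pow (2 * x) = (if x \<in> {1, 3} then - 1 else 1)"
proof -
  have "zeta4_pow (2 * x) = (zeta4_pow x)\<^sup>2"
    by (simp only: mult_2 zeta4_pow_add power2_eq_square)
  thus ?thesis using Z4_cases[of x] by (auto simp: power2_eq_square)
qed

lemma zeta4_pow_triple: "zeta4_pow (3 * x) = (if x \<in> {1, 3} then - 1 else 1) * zeta4_pow x"
proof -
  have "3 * x = 2 * x + x" by simp
  thus ?thesis by (simp only: zeta4_pow_add zeta4_pow_double)
qed

definition odd_support :: "4 vec \<Rightarrow> nat set" where
  "odd_support v = {i. i < dim_vec v \<and> v $ i \<in> {1, 3}}"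

text \<open>\<open>A\<close> is the set of odd coordinates of \<open>b\<close>, and \<open>B\<close>, \<open>C\<close> are its coordinates equal to \<open>3\<close> and
  \<open>2\<close>.\<close>

definition vec_of_sets :: "nat \<Rightarrow> nat set \<Rightarrow> nat set \<Rightarrow> nat set \<Rightarrow> 4 vec" where
  "vec_of_sets n A B C = vec n (\<lambda>i. if i \<in> A then if i \<in> B then 3 else 1 else if i \<in> C then 2 else 0)"

text \<open>An entry 2 of \<open>b\<close> contributes \<open>- 1\<close> exactly at the odd
  coordinates of \<open>v\<close>. Since \<open>3 = 1 + 2\<close>, turning an entry 1 into 3 also
  changes the sign exactly there. Hence \<open>B\<close> and \<open>C\<close> enter only through
  their intersections with the odd support.\<close>

lemma zeta4_pow_vec_of_sets:
  assumes v: "v \<in> carrier_vec n" and A: "A \<subseteq> {..<n}" and B: "B \<subseteq> A" and C: "C \<subseteq> {..<n} - A"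
  shows "zeta4_pow (vec_of_sets n A B C \<bullet> v) = (\<Prod>i\<in>A. zeta4_pow (v $ i)) *
    ((- 1) ^ card (B \<inter> odd_support v) * (- 1) ^ card (C \<inter> odd_support v))"
proof -
  define U where "U = odd_support v"
  have U: "i \<in> U \<longleftrightarrow> v $ i \<in> {1, 3}" if "i < n" for i
    using v that by (auto simp: U_def odd_support_def)
  have fin: "finite A" "finite ({..<n} - A)" using A finite_subset by auto
  have "zeta4_pow (vec_of_sets n A B C \<bullet> v) = (\<Prod>i<n. zeta4_pow (vec_of_sets n A B C $ i * v $ i))"
    using v by (simp add: scalar_prod_def zeta4_pow_sum atLeast0LessThan)
  also have "\<dots> = (\<Prod>i\<in>A. zeta4_pow (vec_of_sets n A B C $ i * v $ i)) *
      (\<Prod>i\<in>{..<n} - A. zeta4_pow (vec_of_sets n A B C $ i * v $ i))"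
    using A by (subst prod.subset_diff[of A]) (auto simp: mult.commute)
  also have "(\<Prod>i\<in>A. zeta4_pow (vec_of_sets n A B C $ i * v $ i))
      = (\<Prod>i\<in>A. zeta4_pow (v $ i) * (if i \<in> B \<inter> U then - 1 else 1))"
    using A by (intro prod.cong refl) (auto simp: vec_of_sets_def zeta4_pow_triple U subset_iff)
  also have "\<dots> = (\<Prod>i\<in>A. zeta4_pow (v $ i)) * (- 1) ^ card (A \<inter> (B \<inter> U))"
    unfolding prod.distrib using fin by (simp only: prod_indicator_sign)
  also have "A \<inter> (B \<inter> U) = B \<inter> U" using B by auto
  also have "(\<Prod>i\<in>{..<n} - A. zeta4_pow (vec_of_sets n A B C $ i * v $ i))
      = (\<Prod>i\<in>{..<n} - A. if i \<in> C \<inter> U then - 1 else 1)"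
    by (intro prod.cong refl) (auto simp: vec_of_sets_def zeta4_pow_double U)
  also have "\<dots> = (- 1) ^ card (({..<n} - A) \<inter> (C \<inter> U))"
    using fin by (simp only: prod_indicator_sign)
  also have "({..<n} - A) \<inter> (C \<inter> U) = C \<inter> U" using C by auto
  finally show ?thesis by (simp add: U_def mult.assoc)
qed

lemma kraw_subsets_inter:
  assumes "finite I"
  shows "(\<Sum>S | S \<subseteq> I \<and> card S = d. (- 1) ^ card (S \<inter> U)) =
    complex_of_real (kraw (card I) (card (I \<inter> U)) d)"
proof -
  have "(\<Sum>S | S \<subseteq> I \<and> card S = d. (- 1) ^ card (S \<inter> U))
      = complex_of_real (\<Sum>S | S \<subseteq> I \<and> card S = d. (- 1) ^ card (S \<inter> (I \<inter> U)))"
    unfolding of_real_sum of_real_power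
  proof (intro sum.cong refl)
    fix S assume "S \<in> {S. S \<subseteq> I \<and> card S = d}"
    hence "S \<inter> (I \<inter> U) = S \<inter> U" by auto
    thus "(- 1) ^ card (S \<inter> U) = complex_of_real (- 1) ^ card (S \<inter> (I \<inter> U))" by simp
  qed
  thus ?thesis using kraw_subsets[OF assms, of "I \<inter> U" d] by simp
qed

text \<open>For fixed \<open>A\<close> the choices of \<open>B\<close> and \<open>C\<close> are
  independent, and each signed count is a Krawtchouk value of middle degree.\<close>

lemma lambda_vec_eq:
  assumes n: "n = 2 * (r + s)" and v: "v \<in> carrier_vec n"
  shows "lambda_vec r s v = (\<Sum>A | A \<subseteq> {..<n} \<and> card A = 2 * s. (\<Prod>i\<in>A. zeta4_pow (v $ i)) *
    of_real (kraw (2 * s) (card (A \<inter> odd_support v)) s *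
      kraw (2 * r) (card (({..<n} - A) \<inter> odd_support v)) r))"
proof -
  define U where "U = odd_support v"
  define \<A> where "\<A> = {A. A \<subseteq> {..<n} \<and> card A = 2 * s}"
  define \<B> where "\<B> A = {B. B \<subseteq> A \<and> card B = s}" for A :: "nat set"
  define \<C> where "\<C> A = {C. C \<subseteq> {..<n} - A \<and> card C = r}" for A :: "nat set"
  define Y where "Y b k = {i. i < dim_vec b \<and> b $ i = k}" for b :: "4 vec" and k :: 4
  have fA: "finite A" "card ({..<n} - A) = 2 * r" if "A \<in> \<A>" for A
    using that n finite_subset[of A "{..<n}"] by (simp_all add: \<A>_def card_Diff_subset)
  \<comment> \<open>The level sets of \<open>b\<close> encode it as a triple, with
    \<open>vec_of_sets\<close> as the inverse map.\<close>
  have "lambda_vec r s v = (\<Sum>(A, B, C) \<in> Sigma \<A> (\<lambda>A. \<B> A \<times> \<C> A). zeta4_pow (vec_of_sets n A B C \<bullet> v))"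
    unfolding lambda_vec_def
  proof (rule sum.reindex_bij_witness[where i = "\<lambda>(A, B, C). vec_of_sets n A B C"
        and j = "\<lambda>b. (Y b 1 \<union> Y b 3, Y b 3, Y b 2)"])
    fix b assume "b \<in> connection_set r s"
    hence dim: "dim_vec b = n" and ty: "card (Y b 0) = r" "card (Y b 1) = s" "card (Y b 2) = r" "card (Y b 3) = s"
      by (auto simp: connection_set_def n vtype_def Y_def)
    have "card (Y b 1 \<union> Y b 3) = 2 * s"
      by (subst card_Un_disjoint) (auto simp: ty, auto simp: Y_def)
    thus "(Y b 1 \<union> Y b 3, Y b 3, Y b 2) \<in> Sigma \<A> (\<lambda>A. \<B> A \<times> \<C> A)"
      using ty by (auto simp: \<A>_def \<B>_def \<C>_def Y_def dim)
    show *: "(case (Y b 1 \<union> Y b 3, Y b 3, Y b 2) of (A, B, C) \<Rightarrow> vec_of_sets n A B C) = b"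
    proof (rule eq_vecI)
      fix i assume "i < dim_vec b"
      thus "(case (Y b 1 \<union> Y b 3, Y b 3, Y b 2) of (A, B, C) \<Rightarrow> vec_of_sets n A B C) $ i = b $ i"
        using Z4_cases[of "b $ i"] by (auto simp: vec_of_sets_def dim Y_def)
    qed (simp add: vec_of_sets_def dim)
    show "(case (Y b 1 \<union> Y b 3, Y b 3, Y b 2) of (A, B, C) \<Rightarrow> zeta4_pow (vec_of_sets n A B C \<bullet> v)) = zeta4_pow (b \<bullet> v)"
      using * by simp
  next
    fix y assume "y \<in> Sigma \<A> (\<lambda>A. \<B> A \<times> \<C> A)"
    then obtain A B C where y: "y = (A, B, C)" and A: "A \<in> \<A>" and B: "B \<in> \<B> A" and C: "C \<in> \<C> A" by auto
    define b where "b = vec_of_sets n A B C"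
    have sub: "A \<subseteq> {..<n}" "B \<subseteq> A" "C \<subseteq> {..<n} - A"
      using A B C by (auto simp: \<A>_def \<B>_def \<C>_def)
    have bi: "b $ i = (if i \<in> A then if i \<in> B then 3 else 1 else if i \<in> C then 2 else 0)" if "i < n" for i
      using that by (simp add: b_def vec_of_sets_def)
    have dim: "dim_vec b = n" by (simp add: b_def vec_of_sets_def)
    have Yb: "Y b 3 = B" "Y b 1 = A - B" "Y b 2 = C" "Y b 0 = ({..<n} - A) - C"
      using sub by (auto simp: Y_def dim bi subset_iff split: if_splits)
    have fB: "finite B" "finite C" using A B C fA finite_subset[of B A] finite_subset[of C "{..<n}"]
      by (auto simp: \<B>_def \<C>_def)
    have yb: "(case y of (A, B, C) \<Rightarrow> vec_of_sets n A B C) = b" by (simp add: y b_def)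
    have "card (Y b 3) = s" "card (Y b 2) = r" using B C by (auto simp: Yb \<B>_def \<C>_def)
    moreover have "card (Y b 1) = s" using A B sub fB by (simp add: Yb card_Diff_subset \<A>_def \<B>_def)
    moreover have "card (Y b 0) = r" using C sub fB fA[OF A] by (simp add: Yb card_Diff_subset \<C>_def)
    ultimately have "vtype b = (r, s, r, s)" by (simp add: vtype_def Y_def)
    moreover have "b \<in> carrier_vec n" using dim by (rule carrier_vecI)
    ultimately show "(case y of (A, B, C) \<Rightarrow> vec_of_sets n A B C) \<in> connection_set r s"
      unfolding yb connection_set_def n[symmetric] by simp
    have "A - B \<union> B = A" using sub by auto
    thus "(Y (case y of (A, B, C) \<Rightarrow> vec_of_sets n A B C) 1 \<union> Y (case y of (A, B, C) \<Rightarrow> vec_of_sets n A B C) 3,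
        Y (case y of (A, B, C) \<Rightarrow> vec_of_sets n A B C) 3, Y (case y of (A, B, C) \<Rightarrow> vec_of_sets n A B C) 2) = y"
      by (simp only: yb Yb) (simp add: y)
  qed
  also have "\<dots> = (\<Sum>A\<in>\<A>. \<Sum>(B, C)\<in>\<B> A \<times> \<C> A. zeta4_pow (vec_of_sets n A B C \<bullet> v))"
  proof (rule sum.Sigma[symmetric])
    show "finite \<A>" by (simp add: \<A>_def)
    show "\<forall>A\<in>\<A>. finite (\<B> A \<times> \<C> A)" using fA by (simp add: \<B>_def \<C>_def)
  qed
  also have "\<dots> = (\<Sum>A\<in>\<A>. (\<Prod>i\<in>A. zeta4_pow (v $ i)) *
      of_real (kraw (2 * s) (card (A \<inter> U)) s * kraw (2 * r) (card (({..<n} - A) \<inter> U)) r))"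
  proof (intro sum.cong refl)
    fix A assume A: "A \<in> \<A>"
    have "(\<Sum>(B, C)\<in>\<B> A \<times> \<C> A. zeta4_pow (vec_of_sets n A B C \<bullet> v))
        = (\<Sum>(B, C)\<in>\<B> A \<times> \<C> A. (\<Prod>i\<in>A. zeta4_pow (v $ i)) * ((- 1) ^ card (B \<inter> U) * (- 1) ^ card (C \<inter> U)))"
      using A v by (intro sum.cong refl) (auto simp: U_def \<A>_def \<B>_def \<C>_def intro!: zeta4_pow_vec_of_sets)
    also have "\<dots> = (\<Prod>i\<in>A. zeta4_pow (v $ i)) *
        ((\<Sum>B\<in>\<B> A. (- 1) ^ card (B \<inter> U)) * (\<Sum>C\<in>\<C> A. (- 1) ^ card (C \<inter> U)))"
      by (simp only: sum_product sum.cartesian_product) (simp only: sum_distrib_left case_prod_unfold)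
    also have "(\<Sum>B\<in>\<B> A. (- 1 :: complex) ^ card (B \<inter> U)) = of_real (kraw (2 * s) (card (A \<inter> U)) s)"
      using kraw_subsets_inter[OF fA(1)[OF A], of U s] A by (simp add: \<B>_def \<A>_def)
    also have "(\<Sum>C\<in>\<C> A. (- 1 :: complex) ^ card (C \<inter> U)) = of_real (kraw (2 * r) (card (({..<n} - A) \<inter> U)) r)"
      using kraw_subsets_inter[of "{..<n} - A" U r] fA[OF A] by (simp add: \<C>_def)
    finally show "(\<Sum>(B, C)\<in>\<B> A \<times> \<C> A. zeta4_pow (vec_of_sets n A B C \<bullet> v)) = (\<Prod>i\<in>A. zeta4_pow (v $ i)) *
        of_real (kraw (2 * s) (card (A \<inter> U)) s * kraw (2 * r) (card (({..<n} - A) \<inter> U)) r)" by simp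
  qed
  finally show ?thesis by (simp add: \<A>_def U_def)
qed

section \<open>The spectrum of the Cayley graph\<close>

lemma
  fixes u b :: "'a :: ab_group_add vec"
  assumes "u \<in> carrier_vec n" "b \<in> carrier_vec n"
  shows vec_diff_add: "u - b + b = u" and vec_add_diff: "u + b - b = u"
    and vec_diff_diff: "u - (u - b) = b"
  using assms by (auto intro!: eq_vecI)

lemma vec_neq_0_nth:
  assumes "v \<in> carrier_vec n" "v \<noteq> 0\<^sub>v n"
  shows "\<exists>i<n. v $ i \<noteq> 0"
proof (rule ccontr)
  assume "\<not> ?thesis"
  hence "v = 0\<^sub>v n" using assms(1) by (intro eq_vecI) auto
  with assms(2) show False by simp
qed

text \<open>Transport along the enumeration turns eigenvectors into functions on \<open>V\<close>,
  which frees the spectrum from the order of the vertices.\<close>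

lemma eigenvalue_adjacency_matrix:
  assumes vs: "distinct vs" "set vs = V"
  shows "eigenvalue (adjacency_matrix vs adj) x \<longleftrightarrow>
    (\<exists>g. (\<exists>u\<in>V. g u \<noteq> 0) \<and> (\<forall>u\<in>V. (\<Sum>w\<in>V. if adj u w then g w else 0) = x * g u))"
    (is "?L \<longleftrightarrow> ?R")
proof -
  define N where "N = length vs"
  define M where "M = adjacency_matrix vs adj"
  have dim: "dim_row M = N" "dim_col M = N" by (auto simp: M_def N_def adjacency_matrix_def)
  have bij: "bij_betw ((!) vs) {..<N} V" using vs by (simp add: N_def bij_betw_nth)
  have mult: "(M *\<^sub>v y) $ i = (\<Sum>w\<in>V. if adj (vs ! i) w then g w else 0)"
    if i: "i < N" and y: "dim_vec y = N" "\<And>j. j < N \<Longrightarrow> y $ j = g (vs ! j)" for y i g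
  proof -
    have "(M *\<^sub>v y) $ i = (\<Sum>j<N. if adj (vs ! i) (vs ! j) then g (vs ! j) else 0)"
      using i y dim
      by (auto simp: scalar_prod_def atLeast0LessThan M_def N_def adjacency_matrix_def intro!: sum.cong)
    also have "\<dots> = (\<Sum>w\<in>V. if adj (vs ! i) w then g w else 0)"
      by (rule sum.reindex_bij_betw[OF bij])
    finally show ?thesis .
  qed
  show ?thesis unfolding M_def[symmetric]
  proof
    assume "eigenvalue M x"
    then obtain y where y: "dim_vec y = N" "y \<noteq> 0\<^sub>v N" "M *\<^sub>v y = x \<cdot>\<^sub>v y"
      by (auto simp: eigenvalue_def eigenvector_def dim dest: carrier_vecD)
    define g where "g w = y $ (the_inv_into {..<N} ((!) vs) w)" for w
    have g: "y $ j = g (vs ! j)" if "j < N" for j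
      using that bij the_inv_into_f_f[of "(!) vs" "{..<N}" j] by (auto simp: g_def bij_betw_def)
    obtain j where "j < N" "y $ j \<noteq> 0" using vec_neq_0_nth[OF carrier_vecI[OF y(1)] y(2)] by blast
    hence j: "j < N" "g (vs ! j) \<noteq> 0" by (simp_all add: g)
    have "(\<Sum>w\<in>V. if adj u w then g w else 0) = x * g u" if u: "u \<in> V" for u
    proof -
      obtain i where i: "i < N" "u = vs ! i" using u vs by (auto simp: in_set_conv_nth N_def)
      have "(M *\<^sub>v y) $ i = x * g u" using i y(1) g[OF i(1)] by (simp add: y(3))
      thus ?thesis using mult[OF i(1) y(1) g] i(2) by simp
    qed
    moreover have "vs ! j \<in> V" using j vs by (auto simp: N_def)
    ultimately show ?R using j(2) by blast
  next
    assume ?R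
    then obtain g u where u: "u \<in> V" "g u \<noteq> 0"
      and g: "\<And>u. u \<in> V \<Longrightarrow> (\<Sum>w\<in>V. if adj u w then g w else 0) = x * g u" by auto
    define y where "y = vec N (\<lambda>j. g (vs ! j))"
    obtain i where i: "i < N" "u = vs ! i" using u vs by (auto simp: in_set_conv_nth N_def)
    have "y $ i \<noteq> 0" using u i by (simp add: y_def)
    hence "y \<noteq> 0\<^sub>v N" using i by auto
    moreover have "M *\<^sub>v y = x \<cdot>\<^sub>v y"
    proof (rule eq_vecI)
      fix j assume "j < dim_vec (x \<cdot>\<^sub>v y)"
      hence j: "j < N" by (simp add: y_def)
      hence "vs ! j \<in> V" using vs by (auto simp: N_def)
      thus "(M *\<^sub>v y) $ j = (x \<cdot>\<^sub>v y) $ j"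
        using mult[of j y g] j g by (simp add: y_def)
    qed (simp add: y_def dim)
    ultimately show "eigenvalue M x"
      by (auto simp: eigenvalue_def eigenvector_def dim y_def intro!: exI[of _ y])
  qed
qed

lemma finite_carrier_vec_finite: "finite (carrier_vec n :: 'a :: finite vec set)"
proof (rule finite_surj)
  show "finite (PiE {..<n} (\<lambda>_. UNIV :: 'a set))" by (intro finite_PiE) auto
  show "carrier_vec n \<subseteq> vec n ` (PiE {..<n} (\<lambda>_. UNIV :: 'a set))"
  proof
    fix v :: "'a vec" assume "v \<in> carrier_vec n"
    hence "v = vec n (restrict (\<lambda>i. v $ i) {..<n})" by auto
    moreover have "restrict (\<lambda>i. v $ i) {..<n} \<in> PiE {..<n} (\<lambda>_. UNIV)" by auto
    ultimately show "v \<in> vec n ` (PiE {..<n} (\<lambda>_. UNIV :: 'a set))" by blast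
  qed
qed

lemma zeta4_pow_eq_1_iff: "zeta4_pow x = 1 \<longleftrightarrow> x = 0"
  using Z4_cases[of x] by (auto simp: complex_eq_iff)

lemma zeta4_pow_uminus: "zeta4_pow (- x) = cnj (zeta4_pow x)"
proof -
  have "zeta4_pow (- x) * zeta4_pow x = 1" by (simp flip: zeta4_pow_add)
  moreover have "cnj (zeta4_pow x) * zeta4_pow x = 1"
    using complex_norm_square[of "zeta4_pow x"] by (simp add: mult.commute)
  moreover have "zeta4_pow x \<noteq> 0" using norm_zeta4_pow[of x] by fastforce
  ultimately show ?thesis by (metis mult_cancel_right)
qed

text \<open>Orthogonality of characters: translation by a unit vector at a coordinate where
  \<open>w\<close> is nonzero multiplies the sum by a number other than 1.\<close>

lemma sum_zeta4_pow_eq_0: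
  assumes w: "w \<in> carrier_vec n" "w \<noteq> 0\<^sub>v n"
  shows "(\<Sum>u\<in>carrier_vec n. zeta4_pow (u \<bullet> w)) = 0"
proof -
  obtain i where i: "i < n" "w $ i \<noteq> 0" using w vec_neq_0_nth by blast
  define e where "e = (unit_vec n i :: 4 vec)"
  have e: "e \<in> carrier_vec n" "e \<bullet> w = w $ i" using i w by (auto simp: e_def)
  have "(\<Sum>u\<in>carrier_vec n. zeta4_pow (u \<bullet> w)) = (\<Sum>u\<in>carrier_vec n. zeta4_pow ((u + e) \<bullet> w))"
  proof (rule sum.reindex_bij_witness[of _ "\<lambda>u. u + e" "\<lambda>u. u - e"])
    fix u :: "4 vec" assume u: "u \<in> carrier_vec n"
    show "u - e + e = u" "u + e - e = u" using u e(1) by (auto simp: vec_diff_add vec_add_diff)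
    thus "zeta4_pow ((u - e + e) \<bullet> w) = zeta4_pow (u \<bullet> w)" by simp
  qed (use e(1) in auto)
  also have "\<dots> = zeta4_pow (w $ i) * (\<Sum>u\<in>carrier_vec n. zeta4_pow (u \<bullet> w))"
    unfolding sum_distrib_left
  proof (intro sum.cong refl)
    fix u :: "4 vec" assume "u \<in> carrier_vec n"
    hence "(u + e) \<bullet> w = u \<bullet> w + w $ i" using e w by (simp add: add_scalar_prod_distrib[of _ n])
    thus "zeta4_pow ((u + e) \<bullet> w) = zeta4_pow (w $ i) * zeta4_pow (u \<bullet> w)"
      by (simp add: zeta4_pow_add)
  qed
  finally have "(1 - zeta4_pow (w $ i)) * (\<Sum>u\<in>carrier_vec n. zeta4_pow (u \<bullet> w)) = 0"
    by (simp add: algebra_simps)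
  thus ?thesis using i by (simp add: zeta4_pow_eq_1_iff)
qed

text \<open>Negation exchanges the entries 1 and 3, which occur equally often. This symmetry makes
  the character sums real.\<close>

lemma connection_set_uminus:
  assumes "b \<in> connection_set r s"
  shows "- b \<in> connection_set r s"
proof -
  have neg: "- x = 0 \<longleftrightarrow> x = 0" "- x = 1 \<longleftrightarrow> x = 3" "- x = 2 \<longleftrightarrow> x = 2" "- x = 3 \<longleftrightarrow> x = 1" for x :: 4
    using Z4_cases[of x] by auto
  have "{i. i < dim_vec (- b) \<and> (- b) $ i = k} = {i. i < dim_vec b \<and> - (b $ i) = k}" for k by auto
  hence "vtype (- b) = (card {i. i < dim_vec b \<and> b $ i = 0}, card {i. i < dim_vec b \<and> b $ i = 3},
     card {i. i < dim_vec b \<and> b $ i = 2}, card {i. i < dim_vec b \<and> b $ i = 1})"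
    by (simp add: vtype_def neg)
  thus ?thesis using assms by (auto simp: connection_set_def vtype_def)
qed

lemma cnj_lambda_vec:
  assumes v: "v \<in> carrier_vec (2 * (r + s))"
  shows "cnj (lambda_vec r s v) = lambda_vec r s v"
proof -
  have "cnj (lambda_vec r s v) = (\<Sum>b\<in>connection_set r s. zeta4_pow ((- b) \<bullet> v))"
    unfolding lambda_vec_def cnj_sum
    using v by (intro sum.cong refl) (auto simp: connection_set_def zeta4_pow_uminus)
  also have "\<dots> = lambda_vec r s v"
    unfolding lambda_vec_def
    by (rule sum.reindex_bij_witness[of _ uminus uminus]) (auto intro: connection_set_uminus)
  finally show ?thesis .
qed

lemma of_real_Re_lambda_vec:
  "v \<in> carrier_vec (2 * (r + s)) \<Longrightarrow> of_real (Re (lambda_vec r s v)) = lambda_vec r s v"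
  using cnj_lambda_vec by (simp add: complex_eq_iff)

lemma sum_cayley_adj:
  fixes g :: "4 vec \<Rightarrow> 'b :: comm_monoid_add"
  assumes S: "S \<subseteq> carrier_vec n" and u: "u \<in> carrier_vec n"
  shows "(\<Sum>w\<in>carrier_vec n. if cayley_adj S u w then g w else 0) = (\<Sum>b\<in>S. g (u - b))"
proof -
  have "(\<Sum>w\<in>carrier_vec n. if cayley_adj S u w then g w else 0)
      = (\<Sum>w\<in>{w \<in> carrier_vec n. u - w \<in> S}. g w)"
    by (simp add: cayley_adj_def sum.inter_filter finite_carrier_vec_finite)
  also have "\<dots> = (\<Sum>b\<in>S. g (u - b))"
  proof (rule sum.reindex_bij_witness[of _ "\<lambda>b. u - b" "\<lambda>w. u - w"])
    fix b assume "b \<in> S"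
    hence "b \<in> carrier_vec n" using S by auto
    thus "u - (u - b) = b" using u by (simp add: vec_diff_diff)
    thus "u - b \<in> {w \<in> carrier_vec n. u - w \<in> S}" using u \<open>b \<in> S\<close> \<open>b \<in> carrier_vec n\<close> by auto
  next
    fix w assume "w \<in> {w \<in> carrier_vec n. u - w \<in> S}"
    thus "u - (u - w) = w" using u by (auto simp: vec_diff_diff)
    thus "g (u - (u - w)) = g w" by simp
  qed auto
  finally show ?thesis .
qed

text \<open>Characters diagonalize the graph. Real parts of characters realize each value as an
  eigenvalue; conversely, the Fourier transform of an eigenfunction is nonzero somewhere, and there
  the convolution identity forces the eigenvalue to be the character sum.\<close>

lemma adjacency_eigenvalues_cayley:
  "adjacency_eigenvalues (carrier_vec (2 * (r + s))) (cayley_adj (connection_set r s))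
    = (\<lambda>v. Re (lambda_vec r s v)) ` carrier_vec (2 * (r + s))"
proof -
  define n where "n = 2 * (r + s)"
  define V where "V = (carrier_vec n :: 4 vec set)"
  define S where "S = connection_set r s"
  have S: "S \<subseteq> V" by (auto simp: S_def V_def n_def connection_set_def)
  have fV: "finite V" by (simp add: V_def finite_carrier_vec_finite)
  have char: "x \<in> adjacency_eigenvalues V (cayley_adj S) \<longleftrightarrow>
      (\<exists>g. (\<exists>u\<in>V. g u \<noteq> 0) \<and> (\<forall>u\<in>V. (\<Sum>b\<in>S. g (u - b)) = x * g u))" for x
  proof -
    have "eigenvalue (adjacency_matrix vs (cayley_adj S)) x \<longleftrightarrow>
        (\<exists>g. (\<exists>u\<in>V. g u \<noteq> 0) \<and> (\<forall>u\<in>V. (\<Sum>b\<in>S. g (u - b)) = x * g u))"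
      if "distinct vs" "set vs = V" for vs
      unfolding eigenvalue_adjacency_matrix[OF that]
      using S by (simp add: sum_cayley_adj V_def cong: conj_cong)
    moreover obtain vs where "distinct vs" "set vs = V" using finite_distinct_list[OF fV] by blast
    ultimately show ?thesis unfolding adjacency_eigenvalues_def by blast
  qed
  have "adjacency_eigenvalues V (cayley_adj S) = (\<lambda>v. Re (lambda_vec r s v)) ` V"
  proof (intro equalityI subsetI)
    fix x assume "x \<in> (\<lambda>v. Re (lambda_vec r s v)) ` V"
    then obtain v where v: "v \<in> V" "x = Re (lambda_vec r s v)" by auto
    hence l: "lambda_vec r s v = of_real x"
      using of_real_Re_lambda_vec[of v r s] by (simp add: V_def n_def)
    \<comment> \<open>The matrix is real, so a real eigenfunction is needed; this one takes the
      value 1 at the origin.\<close>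
    define g where "g u = Re (zeta4_pow (u \<bullet> v))" for u
    have "(\<Sum>b\<in>S. g (u - b)) = x * g u" if u: "u \<in> V" for u
    proof -
      have "(\<Sum>b\<in>S. g (u - b)) = Re (\<Sum>b\<in>S. zeta4_pow ((u - b) \<bullet> v))"
        by (simp add: g_def)
      also have "(\<Sum>b\<in>S. zeta4_pow ((u - b) \<bullet> v)) = (\<Sum>b\<in>S. zeta4_pow (u \<bullet> v) * cnj (zeta4_pow (b \<bullet> v)))"
      proof (intro sum.cong refl)
        fix b assume "b \<in> S"
        hence "(u - b) \<bullet> v = u \<bullet> v + - (b \<bullet> v)"
          using S u v by (simp add: V_def minus_scalar_prod_distrib[of _ n] subset_iff)
        thus "zeta4_pow ((u - b) \<bullet> v) = zeta4_pow (u \<bullet> v) * cnj (zeta4_pow (b \<bullet> v))"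
          by (simp only: zeta4_pow_add zeta4_pow_uminus)
      qed
      also have "\<dots> = zeta4_pow (u \<bullet> v) * cnj (lambda_vec r s v)"
        by (simp add: lambda_vec_def S_def sum_distrib_left)
      also have "Re \<dots> = x * g u" by (simp add: l g_def)
      finally show ?thesis .
    qed
    moreover have "g (0\<^sub>v n) \<noteq> 0" "0\<^sub>v n \<in> V" using v by (auto simp: g_def V_def)
    ultimately show "x \<in> adjacency_eigenvalues V (cayley_adj S)" unfolding char by blast
  next
    fix x assume "x \<in> adjacency_eigenvalues V (cayley_adj S)"
    then obtain g u0 where u0: "u0 \<in> V" "g u0 \<noteq> 0"
      and g: "\<And>u. u \<in> V \<Longrightarrow> (\<Sum>b\<in>S. g (u - b)) = x * g u" unfolding char by blast
    define h where "h v = (\<Sum>u\<in>V. of_real (g u) * zeta4_pow (u \<bullet> v))" for v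
    have "\<exists>v\<in>V. h v \<noteq> 0"
    proof (rule ccontr)
      assume "\<not> (\<exists>v\<in>V. h v \<noteq> 0)"
      \<comment> \<open>Fourier inversion at \<open>u0\<close>: a transform vanishing everywhere
        would force \<open>g u0 = 0\<close>.\<close>
      hence "0 = (\<Sum>v\<in>V. zeta4_pow (- (v \<bullet> u0)) * h v)" by simp
      also have "\<dots> = (\<Sum>v\<in>V. \<Sum>u\<in>V. of_real (g u) * zeta4_pow (v \<bullet> (u - u0)))"
        unfolding h_def sum_distrib_left
      proof (intro sum.cong refl)
        fix v u assume "v \<in> V" "u \<in> V"
        hence eq: "v \<bullet> (u - u0) = - (v \<bullet> u0) + u \<bullet> v"
          using u0 by (simp add: V_def scalar_prod_minus_distrib[of _ n] comm_scalar_prod[of u n v])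
        show "zeta4_pow (- (v \<bullet> u0)) * (of_real (g u) * zeta4_pow (u \<bullet> v))
            = of_real (g u) * zeta4_pow (v \<bullet> (u - u0))"
          by (simp only: eq zeta4_pow_add mult_ac)
      qed
      also have "\<dots> = (\<Sum>u\<in>V. of_real (g u) * (\<Sum>v\<in>V. zeta4_pow (v \<bullet> (u - u0))))"
        by (subst sum.swap) (simp add: sum_distrib_left)
      also have "\<dots> = (\<Sum>u\<in>V. if u = u0 then of_real (g u0) * of_nat (card V) else 0)"
      proof (intro sum.cong refl)
        fix u assume u: "u \<in> V"
        show "of_real (g u) * (\<Sum>v\<in>V. zeta4_pow (v \<bullet> (u - u0)))
            = (if u = u0 then of_real (g u0) * of_nat (card V) else 0)"
        proof (cases "u = u0")
          case True
          have "(\<Sum>v\<in>V. zeta4_pow (v \<bullet> (u0 - u0))) = (\<Sum>v\<in>V. 1)"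
            using u0 by (intro sum.cong refl) (auto simp: V_def)
          thus ?thesis using True by simp
        next
          case False
          have "u - u0 \<noteq> 0\<^sub>v n"
          proof
            assume z: "u - u0 = 0\<^sub>v n"
            have "u = u0"
            proof (rule eq_vecI)
              fix i assume i: "i < dim_vec u0"
              hence "(u - u0) $ i = 0" using z u0 by (auto simp: V_def)
              thus "u $ i = u0 $ i" using i u0 u by (simp add: V_def)
            qed (use u u0 in \<open>auto simp: V_def\<close>)
            with False show False by simp
          qed
          thus ?thesis using False u u0 sum_zeta4_pow_eq_0[of "u - u0" n] by (simp add: V_def)
        qed
      qed
      also have "\<dots> = of_real (g u0) * of_nat (card V)"
        using u0 fV by simp
      finally show False using u0 fV by auto
    qed
    then obtain v where v: "v \<in> V" "h v \<noteq> 0" by auto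
    have "of_real x * h v = (\<Sum>u\<in>V. \<Sum>b\<in>S. of_real (g (u - b)) * zeta4_pow (u \<bullet> v))"
      unfolding h_def sum_distrib_left
    proof (intro sum.cong refl)
      fix u assume u: "u \<in> V"
      have "of_real x * (of_real (g u) * zeta4_pow (u \<bullet> v)) = of_real (x * g u) * zeta4_pow (u \<bullet> v)" by simp
      also have "\<dots> = of_real (\<Sum>b\<in>S. g (u - b)) * zeta4_pow (u \<bullet> v)" by (simp only: g[OF u])
      also have "\<dots> = (\<Sum>b\<in>S. of_real (g (u - b)) * zeta4_pow (u \<bullet> v))"
        by (simp only: of_real_sum sum_distrib_right)
      finally show "of_real x * (of_real (g u) * zeta4_pow (u \<bullet> v))
          = (\<Sum>b\<in>S. of_real (g (u - b)) * zeta4_pow (u \<bullet> v))" .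
    qed
    also have "\<dots> = (\<Sum>b\<in>S. \<Sum>u\<in>V. of_real (g (u - b)) * zeta4_pow (u \<bullet> v))"
      by (rule sum.swap)
    \<comment> \<open>Translating by \<open>b\<close> splits off the factor \<open>zeta4_pow\<close>
      of the product of \<open>b\<close> with \<open>v\<close>, which does not depend on
      \<open>w\<close>.\<close>
    also have "\<dots> = (\<Sum>b\<in>S. \<Sum>w\<in>V. of_real (g w) * zeta4_pow (w \<bullet> v) * zeta4_pow (b \<bullet> v))"
    proof (rule sum.cong[OF refl])
      fix b assume "b \<in> S"
      hence b: "b \<in> carrier_vec n" using S by (auto simp: V_def)
      show "(\<Sum>u\<in>V. of_real (g (u - b)) * zeta4_pow (u \<bullet> v))
          = (\<Sum>w\<in>V. of_real (g w) * zeta4_pow (w \<bullet> v) * zeta4_pow (b \<bullet> v))"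
      proof (rule sum.reindex_bij_witness[of _ "\<lambda>w. w + b" "\<lambda>u. u - b"])
        fix u assume u: "u \<in> V"
        show *: "u - b + b = u" using u b by (simp add: V_def vec_diff_add)
        show "u - b \<in> V" using u b by (simp add: V_def)
        hence "(u - b + b) \<bullet> v = (u - b) \<bullet> v + b \<bullet> v"
          using b v by (intro add_scalar_prod_distrib[of _ n]) (auto simp: V_def)
        thus "of_real (g (u - b)) * zeta4_pow ((u - b) \<bullet> v) * zeta4_pow (b \<bullet> v)
            = of_real (g (u - b)) * zeta4_pow (u \<bullet> v)"
          unfolding * by (simp add: zeta4_pow_add)
      next
        fix w assume w: "w \<in> V"
        show "w + b - b = w" using w b by (simp add: V_def vec_add_diff)
        show "w + b \<in> V" using w b by (simp add: V_def)
      qed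
    qed
    also have "\<dots> = lambda_vec r s v * h v"
      unfolding lambda_vec_def h_def S_def[symmetric] sum_product
      by (intro sum.cong refl) (simp add: mult_ac)
    finally have "of_real x = lambda_vec r s v" using v by simp
    hence "x = Re (lambda_vec r s v)" by (metis Re_complex_of_real)
    with v show "x \<in> (\<lambda>v. Re (lambda_vec r s v)) ` V" by blast
  qed
  thus ?thesis by (simp add: V_def S_def n_def)
qed

section \<open>Bounds for the eigenvalues\<close>

lemma kraw_central_sign:
  assumes "m \<le> s"
  shows "kraw (2 * s) (2 * m) s = (- 1) ^ m * \<bar>kraw (2 * s) (2 * m) s\<bar>"
proof -
  define c where "c = real (2 * s choose (2 * m))"
  define e where "e = real (2 * s choose s) * real (s choose m)"
  have c: "c > 0" using assms by (simp add: c_def)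
  have e: "e \<ge> 0" by (simp add: e_def)
  have eq: "kraw (2 * s) (2 * m) s * c = (- 1) ^ m * e"
    using kraw_central_even[OF assms] by (simp add: c_def e_def)
  hence "\<bar>kraw (2 * s) (2 * m) s * c\<bar> = e" using e by (simp add: abs_mult power_abs)
  hence "\<bar>kraw (2 * s) (2 * m) s\<bar> * c = e" using c by (simp add: abs_mult)
  with eq have "kraw (2 * s) (2 * m) s * c = ((- 1) ^ m * \<bar>kraw (2 * s) (2 * m) s\<bar>) * c"
    by simp
  thus ?thesis using c by simp
qed

lemma kraw_central_full: "kraw (2 * s) (2 * s) s = (- 1) ^ s * real (2 * s choose s)"
  using kraw_central_even[of s s] by simp

lemma odd_support_subset: "v \<in> carrier_vec n \<Longrightarrow> odd_support v \<subseteq> {..<n}"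
  by (auto simp: odd_support_def)

lemma card_odd_support_split:
  assumes "v \<in> carrier_vec n" "A \<subseteq> {..<n}"
  shows "card (A \<inter> odd_support v) + card (({..<n} - A) \<inter> odd_support v) = card (odd_support v)"
proof -
  have "finite (odd_support v)" using odd_support_subset[OF assms(1)] finite_subset by blast
  hence "card (A \<inter> odd_support v \<union> ({..<n} - A) \<inter> odd_support v)
      = card (A \<inter> odd_support v) + card (({..<n} - A) \<inter> odd_support v)"
    by (intro card_Un_disjoint) auto
  moreover have "A \<inter> odd_support v \<union> ({..<n} - A) \<inter> odd_support v = odd_support v"
    using odd_support_subset[OF assms(1)] by auto
  ultimately show ?thesis by simp
qed

lemma card_subset_complement:
  assumes "A \<subseteq> {..<n}" "card A = 2 * s" "n = 2 * (r + s)"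
  shows "finite A" "card ({..<n} - A) = 2 * r"
  using assms finite_subset[of A "{..<n}"] by (simp_all add: card_Diff_subset)

text \<open>For each \<open>A\<close>, one of the two parts of the odd support has odd size, and its
  Krawtchouk factor vanishes.\<close>

lemma lambda_vec_odd_support_odd:
  assumes n: "n = 2 * (r + s)" and v: "v \<in> carrier_vec n" and odd: "odd (card (odd_support v))"
  shows "lambda_vec r s v = 0"
  unfolding lambda_vec_eq[OF n v]
proof (intro sum.neutral ballI)
  fix A assume "A \<in> {A. A \<subseteq> {..<n} \<and> card A = 2 * s}"
  hence A: "A \<subseteq> {..<n}" "card A = 2 * s" by auto
  define a where "a = card (A \<inter> odd_support v)"
  define b where "b = card (({..<n} - A) \<inter> odd_support v)"
  have "a \<le> 2 * s"
    using card_mono[of A "A \<inter> odd_support v"] card_subset_complement[OF A n] A by (simp add: a_def)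
  moreover have "b \<le> 2 * r"
    using card_mono[of "{..<n} - A" "({..<n} - A) \<inter> odd_support v"] card_subset_complement[OF A n]
    by (simp add: b_def)
  moreover have "odd a \<or> odd b"
    using card_odd_support_split[OF v A(1)] odd unfolding a_def b_def by (metis odd_add)
  ultimately have "kraw (2 * s) a s * kraw (2 * r) b r = 0"
    using kraw_central_odd[of a s] kraw_central_odd[of b r] by auto
  thus "(\<Prod>i\<in>A. zeta4_pow (v $ i)) * complex_of_real (kraw (2 * s) (card (A \<inter> odd_support v)) s *
      kraw (2 * r) (card (({..<n} - A) \<inter> odd_support v)) r) = 0"
    by (simp add: a_def b_def)
qed

text \<open>The unimodular factors disappear in the triangle inequality;
  \<open>sum_kraw_central\<close> evaluates the remaining sum and \<open>choose_double_ge\<close>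
  bounds the quotient of binomials.\<close>

lemma norm_lambda_vec_le:
  assumes n: "n = 2 * (r + s)" and v: "v \<in> carrier_vec n"
    and k: "card (odd_support v) = 2 * k" "1 \<le> k" "k < r + s"
  shows "norm (lambda_vec r s v)
    \<le> real (n choose (2 * s)) * real (2 * s choose s) * real (2 * r choose r) / (real n - 1)"
proof -
  define M where "M = real (n choose (2 * s)) * real (2 * s choose s) * real (2 * r choose r)"
  define L where "L = (\<Sum>A | A \<subseteq> {..<n} \<and> card A = 2 * s.
        \<bar>kraw (2 * s) (card (A \<inter> odd_support v)) s * kraw (2 * r) (card (({..<n} - A) \<inter> odd_support v)) r\<bar>)"
  define c where "c = real (n choose (2 * k))"
  have c: "c > 0" using k n by (simp add: c_def)
  have n1: "real n - 1 > 0" using k n by simp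
  have "norm (lambda_vec r s v) \<le> L"
    unfolding lambda_vec_eq[OF n v] L_def
    by (rule order_trans[OF norm_sum])
      (simp add: norm_mult abs_mult flip: prod_norm)
  moreover have "L * c = M * real ((r + s) choose k)"
    using sum_kraw_central[OF n, of k "{..<n}" "odd_support v"] odd_support_subset[OF v] k n
    by (simp add: L_def c_def M_def)
  moreover have "real ((2 * (r + s) - 1) * ((r + s) choose k)) \<le> c"
    unfolding c_def n of_nat_le_iff using k by (intro choose_double_ge) auto
  hence "(real n - 1) * real ((r + s) choose k) \<le> c"
    using k n by (simp add: of_nat_diff)
  hence "M * ((real n - 1) * real ((r + s) choose k)) \<le> M * c"
    by (intro mult_left_mono) (auto simp: M_def)
  moreover have "(L * (real n - 1)) * c = (real n - 1) * (L * c)" by simp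
  ultimately have "(L * (real n - 1)) * c \<le> M * c" by (simp only: mult_ac)
  hence "L * (real n - 1) \<le> M" using c by simp
  hence "L \<le> M / (real n - 1)" using n1 by (simp add: field_simps)
  with \<open>norm (lambda_vec r s v) \<le> L\<close> show ?thesis by (simp add: M_def)
qed

text \<open>All coordinates of \<open>v\<close> are 0 or 2, so both middle-degree factors are taken
  at argument 0 and the product over \<open>A\<close> is a sign.\<close>

lemma lambda_vec_even_coords:
  assumes n: "n = 2 * (r + s)" and v: "v \<in> carrier_vec n" and U: "odd_support v = {}"
  shows "lambda_vec r s v = of_real (real (2 * s choose s) * real (2 * r choose r) *
    kraw n (card {i. i < n \<and> v $ i = 2}) (2 * s))"
proof -
  define T where "T = {i. i < n \<and> v $ i = 2}"
  have T: "T \<subseteq> {..<n}" by (auto simp: T_def)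
  define c where "c = real (2 * s choose s) * real (2 * r choose r)"
  have "lambda_vec r s v = (\<Sum>A | A \<subseteq> {..<n} \<and> card A = 2 * s. (- 1) ^ card (A \<inter> T) * of_real c)"
    unfolding lambda_vec_eq[OF n v]
  proof (intro sum.cong refl)
    fix A assume "A \<in> {A. A \<subseteq> {..<n} \<and> card A = 2 * s}"
    hence A: "A \<subseteq> {..<n}" "card A = 2 * s" by auto
    have "(\<Prod>i\<in>A. zeta4_pow (v $ i)) = (\<Prod>i\<in>A. if i \<in> T then - 1 else 1)"
    proof (intro prod.cong refl)
      fix i assume i: "i \<in> A"
      hence "i < n" using A by auto
      moreover from this have "v $ i \<notin> {1, 3}" using U v by (auto simp: odd_support_def)
      ultimately show "zeta4_pow (v $ i) = (if i \<in> T then - 1 else 1)"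
        using Z4_cases[of "v $ i"] by (auto simp: T_def)
    qed
    thus "(\<Prod>i\<in>A. zeta4_pow (v $ i)) * complex_of_real (kraw (2 * s) (card (A \<inter> odd_support v)) s *
        kraw (2 * r) (card (({..<n} - A) \<inter> odd_support v)) r) = (- 1) ^ card (A \<inter> T) * of_real c"
      using prod_indicator_sign[OF card_subset_complement(1)[OF A n], of T, where 'b = complex]
      by (simp add: U kraw_0 c_def)
  qed
  also have "\<dots> = of_real (kraw n (card T) (2 * s)) * of_real c"
    unfolding sum_distrib_right[symmetric]
    using kraw_subsets_inter[of "{..<n}" T "2 * s"] Int_absorb1[OF T] by simp
  finally show ?thesis by (simp add: c_def T_def)
qed

text \<open>The sign \<open>(- 1) ^ s\<close> coming from the \<open>2 * s\<close> imaginary factors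
  cancels the sign of the Krawtchouk factor on \<open>A\<close>. The factor on the complement has
  sign \<open>(- 1) ^ r\<close>, which is 1 because \<open>r\<close> is even.\<close>

lemma lambda_vec_odd_coords:
  assumes n: "n = 2 * (r + s)" and v: "v \<in> carrier_vec n" and U: "odd_support v = {..<n}"
    and r: "even r"
  shows "lambda_vec r s v = of_real (real (2 * s choose s) * real (2 * r choose r) *
    kraw n (card {i. i < n \<and> v $ i = 3}) (2 * s))"
proof -
  define T where "T = {i. i < n \<and> v $ i = 3}"
  have T: "T \<subseteq> {..<n}" by (auto simp: T_def)
  define c where "c = real (2 * s choose s) * real (2 * r choose r)"
  have "lambda_vec r s v = (\<Sum>A | A \<subseteq> {..<n} \<and> card A = 2 * s. (- 1) ^ card (A \<inter> T) * of_real c)"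
    unfolding lambda_vec_eq[OF n v]
  proof (intro sum.cong refl)
    fix A assume "A \<in> {A. A \<subseteq> {..<n} \<and> card A = 2 * s}"
    hence A: "A \<subseteq> {..<n}" "card A = 2 * s" by auto
    have "(\<Prod>i\<in>A. zeta4_pow (v $ i)) = (\<Prod>i\<in>A. \<i> * (if i \<in> T then - 1 else 1))"
    proof (intro prod.cong refl)
      fix i assume i: "i \<in> A"
      hence "i < n" using A by auto
      moreover from this have "v $ i \<in> {1, 3}" using U by (auto simp: odd_support_def)
      ultimately show "zeta4_pow (v $ i) = \<i> * (if i \<in> T then - 1 else 1)"
        by (auto simp: T_def)
    qed
    also have "\<dots> = \<i> ^ (2 * s) * (- 1) ^ card (A \<inter> T)"
      unfolding prod.distrib prod_indicator_sign[OF card_subset_complement(1)[OF A n]]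
      by (simp add: A)
    also have "\<i> ^ (2 * s) = (- 1) ^ s" by (simp add: power_mult)
    finally have "(\<Prod>i\<in>A. zeta4_pow (v $ i)) = (- 1) ^ s * (- 1) ^ card (A \<inter> T)" .
    moreover have "A \<inter> odd_support v = A" "({..<n} - A) \<inter> odd_support v = {..<n} - A"
      using A U by auto
    moreover have "(- 1 :: complex) ^ s * (- 1) ^ s = 1" by (simp flip: power_add)
    ultimately show "(\<Prod>i\<in>A. zeta4_pow (v $ i)) * complex_of_real (kraw (2 * s) (card (A \<inter> odd_support v)) s *
        kraw (2 * r) (card (({..<n} - A) \<inter> odd_support v)) r) = (- 1) ^ card (A \<inter> T) * of_real c"
      using r by (simp add: A(2) card_subset_complement[OF A n] kraw_central_full c_def)
  qed
  also have "\<dots> = of_real (kraw n (card T) (2 * s)) * of_real c"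
    unfolding sum_distrib_right[symmetric]
    using kraw_subsets_inter[of "{..<n}" T "2 * s"] Int_absorb1[OF T] by simp
  finally show ?thesis by (simp add: c_def T_def)
qed

text \<open>The equality case of the triangle inequality: no summand is positive, so the eigenvalue
  is minus the absolute sum, which \<open>sum_kraw_central\<close> gives for
  \<open>k = 1\<close>.\<close>

lemma lambda_vec_two_odd_coords:
  assumes n: "n = 2 * (r + s)" and v: "v \<in> carrier_vec n" and p: "p < n" "v $ p = 1"
    and q: "q < n" "v $ q = 3" and two: "\<And>i. i < n \<Longrightarrow> i \<noteq> p \<Longrightarrow> i \<noteq> q \<Longrightarrow> v $ i = 2"
  shows "lambda_vec r s v = - of_real (real (n choose (2 * s)) * real (2 * s choose s) *
    real (2 * r choose r) / (real n - 1))"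
proof -
  define M where "M = real (n choose (2 * s)) * real (2 * s choose s) * real (2 * r choose r)"
  define U where "U = odd_support v"
  have pq: "p \<noteq> q" using p q by auto
  have U: "U = {p, q}" using v p q two by (force simp: U_def odd_support_def)
  hence cU: "card U = 2 * 1" using pq by simp
  define L where "L = (\<Sum>A | A \<subseteq> {..<n} \<and> card A = 2 * s.
        \<bar>kraw (2 * s) (card (A \<inter> U)) s * kraw (2 * r) (card (({..<n} - A) \<inter> U)) r\<bar>)"
  have n0: "n \<ge> 2" using n p(1) by presburger
  have "U \<subseteq> {..<n}" using U p q by simp
  hence L2: "L * real (n choose 2) = M * real (r + s)"
    using sum_kraw_central[OF n, of 1 "{..<n}" U] cU n0 unfolding L_def M_def by simp
  have "2 * real (n choose 2) = real n * (real n - 1)"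
    using choose_Suc_real[of 1 n] by (simp add: numeral_2_eq_2)
  hence "real n * (L * (real n - 1)) = 2 * (L * real (n choose 2))" by simp
  also have "\<dots> = M * (2 * real (r + s))" unfolding L2 by simp
  also have "2 * real (r + s) = real n" using n by simp
  finally have "real n * (L * (real n - 1)) = real n * M" by simp
  hence "L * (real n - 1) = M" using n0 by simp
  hence L: "L = M / (real n - 1)" using n0 by (simp add: field_simps)
  have "lambda_vec r s v = (\<Sum>A | A \<subseteq> {..<n} \<and> card A = 2 * s.
      - of_real \<bar>kraw (2 * s) (card (A \<inter> U)) s * kraw (2 * r) (card (({..<n} - A) \<inter> U)) r\<bar>)"
    unfolding lambda_vec_eq[OF n v] U_def[symmetric]
  proof (intro sum.cong refl)
    fix A assume "A \<in> {A. A \<subseteq> {..<n} \<and> card A = 2 * s}"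
    hence A: "A \<subseteq> {..<n}" "card A = 2 * s" by auto
    note fA = card_subset_complement[OF A n]
    define a where "a = card (A \<inter> U)"
    define b where "b = card (({..<n} - A) \<inter> U)"
    define K where "K = kraw (2 * s) a s * kraw (2 * r) b r"
    have ab: "a + b = 2" using card_odd_support_split[OF v A(1)] cU by (simp add: a_def b_def U_def)
    have a2: "a \<le> 2 * s" using card_mono[of A "A \<inter> U"] fA A by (simp add: a_def)
    have b2: "b \<le> 2 * r" using card_mono[of "{..<n} - A" "({..<n} - A) \<inter> U"] fA by (simp add: b_def)
    \<comment> \<open>Extracting \<open>- 1\<close> from each of the \<open>2 * s\<close> factors
      changes nothing overall and leaves 1 at every coordinate where \<open>v\<close> equals
      2.\<close>
    have "(\<Prod>i\<in>A. zeta4_pow (v $ i)) = (\<Prod>i\<in>A. (- 1) * (if i \<in> U then - zeta4_pow (v $ i) else 1))"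
      using A two U by (intro prod.cong refl) auto
    also have "\<dots> = (\<Prod>i\<in>A. if i \<in> U then - zeta4_pow (v $ i) else 1)"
      unfolding prod.distrib by (simp add: A)
    also have "\<dots> = (\<Prod>i\<in>A \<inter> U. - zeta4_pow (v $ i))"
      using fA by (simp add: prod.inter_restrict)
    finally have P: "(\<Prod>i\<in>A. zeta4_pow (v $ i)) = (\<Prod>i\<in>A \<inter> U. - zeta4_pow (v $ i))" .
    \<comment> \<open>If \<open>A\<close> separates \<open>p\<close> and \<open>q\<close>, the
      summand is 0. Otherwise the product is 1, since \<open>- \<i>\<close> and \<open>\<i>\<close>
      multiply to 1, and exactly one Krawtchouk factor carries a minus sign.\<close>
    consider "a = 0" "b = 2" | "a = 1" | "a = 2" "b = 0" using ab by linarith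
    hence "(\<Prod>i\<in>A. zeta4_pow (v $ i)) * of_real K = - of_real \<bar>K\<bar>"
    proof cases
      case 1
      hence "A \<inter> U = {}" using fA by (simp add: a_def)
      moreover have "K = - \<bar>K\<bar>"
        using kraw_central_sign[of 0 s] kraw_central_sign[of 1 r] 1 b2
        by (simp add: K_def abs_mult)
      ultimately show ?thesis unfolding P by (metis mult_1 of_real_minus prod.empty)
    next
      case 2
      hence "K = 0" using kraw_central_odd[of 1 s] a2 by (simp add: K_def)
      thus ?thesis by simp
    next
      case 3
      have "A \<inter> U = U"
        using 3 cU U by (intro card_subset_eq) (auto simp: a_def)
      hence "(\<Prod>i\<in>A \<inter> U. - zeta4_pow (v $ i)) = 1" using U pq p q by simp
      moreover have "K = - \<bar>K\<bar>"
        using kraw_central_sign[of 1 s] kraw_central_sign[of 0 r] 3 a2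
        by (simp add: K_def abs_mult)
      ultimately show ?thesis unfolding P by (metis mult_1 of_real_minus)
    qed
    thus "(\<Prod>i\<in>A. zeta4_pow (v $ i)) * complex_of_real (kraw (2 * s) (card (A \<inter> U)) s *
        kraw (2 * r) (card (({..<n} - A) \<inter> U)) r) =
      - of_real \<bar>kraw (2 * s) (card (A \<inter> U)) s * kraw (2 * r) (card (({..<n} - A) \<inter> U)) r\<bar>"
      by (simp only: K_def a_def b_def)
  qed
  also have "\<dots> = - of_real L" by (simp add: L_def sum_negf)
  finally show ?thesis by (simp add: L M_def)
qed

section \<open>The smallest eigenvalue\<close>

text \<open>The number of odd coordinates of \<open>v\<close> decides: odd numbers give 0, the
  extreme values 0 and \<open>n\<close> fall under the hypothesis on Krawtchouk values, and all
  others under the norm bound.\<close>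

lemma Re_lambda_vec_ge:
  assumes n: "n = 2 * (r + s)" and v: "v \<in> carrier_vec n" and r: "even r" and n2: "n \<ge> 2"
    and kraw: "\<And>t. t \<le> n \<Longrightarrow> kraw n t (2 * s) \<ge> - (real (n choose (2 * s)) / (real n - 1))"
  shows "Re (lambda_vec r s v)
    \<ge> - (real (n choose (2 * s)) * real (2 * s choose s) * real (2 * r choose r) / (real n - 1))"
proof -
  define c where "c = real (2 * s choose s) * real (2 * r choose r)"
  define M where "M = real (n choose (2 * s)) * real (2 * s choose s) * real (2 * r choose r)"
  have M0: "M / (real n - 1) \<ge> 0" using n2 by (simp add: M_def)
  have *: "c * kraw n (card {i. i < n \<and> P i}) (2 * s) \<ge> - (M / (real n - 1))" for P
  proof -
    have "card {i. i < n \<and> P i} \<le> card {..<n}" by (intro card_mono) auto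
    hence "c * (- (real (n choose (2 * s)) / (real n - 1))) \<le> c * kraw n (card {i. i < n \<and> P i}) (2 * s)"
      by (intro mult_left_mono kraw) (auto simp: c_def)
    thus ?thesis by (simp add: M_def c_def mult_ac)
  qed
  have U: "odd_support v \<subseteq> {..<n}" by (rule odd_support_subset[OF v])
  have fU: "finite (odd_support v)" using U finite_subset by blast
  have le: "card (odd_support v) \<le> n" using card_mono[OF _ U] by simp
  have "Re (lambda_vec r s v) \<ge> - (M / (real n - 1))"
  proof (cases "even (card (odd_support v))")
    case False
    thus ?thesis using lambda_vec_odd_support_odd[OF n v] M0 by simp
  next
    case True
    then obtain k where k: "card (odd_support v) = 2 * k" by blast
    have "k = 0 \<or> 2 * k = n \<or> 1 \<le> k \<and> k < r + s" using le k n by presburger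
    then consider "k = 0" | "2 * k = n" | "1 \<le> k" "k < r + s" by blast
    thus ?thesis
    proof cases
      case 1
      hence "odd_support v = {}" using k fU by simp
      from lambda_vec_even_coords[OF n v this] *[of "\<lambda>i. v $ i = 2"] show ?thesis
        by (simp add: c_def)
    next
      case 2
      hence "odd_support v = {..<n}" using k by (intro card_subset_eq[OF _ U]) auto
      from lambda_vec_odd_coords[OF n v this r] *[of "\<lambda>i. v $ i = 3"] show ?thesis
        by (simp add: c_def)
    next
      case 3
      have "norm (lambda_vec r s v) \<le> M / (real n - 1)"
        unfolding M_def by (rule norm_lambda_vec_le[OF n v k 3])
      thus ?thesis using abs_Re_le_cmod[of "lambda_vec r s v"] by linarith
    qed
  qed
  thus ?thesis by (simp add: M_def)
qed

text \<open>The left side chooses the odd positions first and then splits the odd and the even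
  positions into equal halves.\<close>

lemma multinomial_eq_fact:
  assumes n: "n = 2 * (r + s)"
  shows "real (n choose (2 * s)) * real (2 * s choose s) * real (2 * r choose r)
    = fact n / ((fact r)\<^sup>2 * (fact s)\<^sup>2)"
proof -
  have "n - 2 * s = 2 * r" using n by simp
  hence "real (n choose (2 * s)) = fact n / (fact (2 * s) * fact (2 * r))"
    using n by (subst binomial_fact) auto
  moreover have "real (2 * k choose k) = fact (2 * k) / (fact k)\<^sup>2" for k
    by (subst binomial_fact) (auto simp: power2_eq_square mult_2)
  ultimately show ?thesis by simp
qed

text \<open>Both regimes are reduced here to a lower bound for Krawtchouk values of degree
  \<open>2 * s\<close>; the vector \<open>v\<close> attains the bound of
  \<open>Re_lambda_vec_ge\<close>.\<close>

lemma lambda_min_eq_if_kraw_ge: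
  assumes n: "n = 2 * (r + s)" and r: "even r" and n2: "n \<ge> 2"
    and kraw: "\<And>t. t \<le> n \<Longrightarrow> kraw n t (2 * s) \<ge> - (real (n choose (2 * s)) / (real n - 1))"
  shows "complex_of_real (lambda_min r s) = lambda_type r s (0, 1, n - 2, 1) \<and>
    lambda_min r s = - (fact n / ((fact r)\<^sup>2 * (fact s)\<^sup>2)) / (real n - 1)"
proof -
  define m where "m = - (real (n choose (2 * s)) * real (2 * s choose s) * real (2 * r choose r) / (real n - 1))"
  define v :: "4 vec" where "v = vec n (\<lambda>i. if i = 0 then 1 else if i = 1 then 3 else 2)"
  have v: "v \<in> carrier_vec n" by (simp add: v_def)
  have lv: "lambda_vec r s v = of_real m"
    using lambda_vec_two_odd_coords[OF n v, of 0 1] n2 by (simp add: v_def m_def)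
  have "{i. i < n \<and> v $ i = 0} = {}" "{i. i < n \<and> v $ i = 1} = {0}"
    "{i. i < n \<and> v $ i = 2} = {2..<n}" "{i. i < n \<and> v $ i = 3} = {1}"
    using n2 by (auto simp: v_def split: if_splits)
  moreover have "dim_vec v = n" by (simp add: v_def)
  ultimately have "vtype v = (0, 1, n - 2, 1)" by (simp add: vtype_def)
  hence lt: "lambda_type r s (0, 1, n - 2, 1) = of_real m"
    using lambda_type_vtype[of v r s] v lv n by simp
  have "lambda_min r s = Min ((\<lambda>v. Re (lambda_vec r s v)) ` carrier_vec n)"
    unfolding lambda_min_def adjacency_eigenvalues_cayley n ..
  also have "\<dots> = m"
  proof (rule Min_eqI)
    show "finite ((\<lambda>v. Re (lambda_vec r s v)) ` carrier_vec n)"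
      by (simp add: finite_carrier_vec_finite)
    show "m \<in> (\<lambda>v. Re (lambda_vec r s v)) ` carrier_vec n"
      using v lv by (intro image_eqI[of _ _ v]) auto
    fix y assume "y \<in> (\<lambda>v. Re (lambda_vec r s v)) ` carrier_vec n"
    thus "m \<le> y" using Re_lambda_vec_ge[OF n _ r n2 kraw] by (auto simp: m_def)
  qed
  finally have m: "lambda_min r s = m" .
  show ?thesis
  proof
    show "complex_of_real (lambda_min r s) = lambda_type r s (0, 1, n - 2, 1)" unfolding m lt ..
    show "lambda_min r s = - (fact n / ((fact r)\<^sup>2 * (fact s)\<^sup>2)) / (real n - 1)"
      unfolding m m_def multinomial_eq_fact[OF n] by simp
  qed
qed

theorem theorem5:
  "(\<forall>s::nat\<ge>2. \<exists>N::nat. \<forall>r n :: nat.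
      r \<ge> s \<and> even r \<and> n = 2 * (r + s) \<and> n \<ge> N \<longrightarrow>
        complex_of_real (lambda_min r s) = lambda_type r s (0, 1, n - 2, 1) \<and>
        lambda_min r s = - (fact n / ((fact r)\<^sup>2 * (fact s)\<^sup>2)) / (real n - 1)) \<and>
   (\<forall>\<alpha>::real. 0 < \<alpha> \<and> \<alpha> \<le> 0.17 \<longrightarrow> (\<exists>N::nat. \<forall>r s n :: nat.
      r \<ge> s \<and> even r \<and> n = 2 * (r + s) \<and> real s = \<alpha> * (real n / 2) \<and> n \<ge> N \<longrightarrow>
        complex_of_real (lambda_min r s) = lambda_type r s (0, 1, n - 2, 1) \<and>
        lambda_min r s = - (fact n / ((fact r)\<^sup>2 * (fact s)\<^sup>2)) / (real n - 1)))"
proof (intro conjI[of "\<forall>s\<ge>2. _ s"] allI impI)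
  fix s :: nat
  assume s: "s \<ge> 2"
  then obtain N where N: "\<And>n t. n \<ge> N \<Longrightarrow> t \<le> n \<Longrightarrow>
      kraw n t (2 * s) \<ge> - (real (n choose (2 * s)) / (real n - 1))"
    using kraw_ge_fixed_degree by meson
  show "\<exists>N::nat. \<forall>r n :: nat. r \<ge> s \<and> even r \<and> n = 2 * (r + s) \<and> n \<ge> N \<longrightarrow>
      complex_of_real (lambda_min r s) = lambda_type r s (0, 1, n - 2, 1) \<and>
      lambda_min r s = - (fact n / ((fact r)\<^sup>2 * (fact s)\<^sup>2)) / (real n - 1)"
  proof (intro exI[of _ N] allI impI, elim conjE)
    fix r n :: nat
    assume r: "even r" and n: "n = 2 * (r + s)" and "n \<ge> N"
    have "n \<ge> 2" using n s by simp
    from lambda_min_eq_if_kraw_ge[OF n r this N[OF \<open>n \<ge> N\<close>]]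
    show "complex_of_real (lambda_min r s) = lambda_type r s (0, 1, n - 2, 1) \<and>
        lambda_min r s = - (fact n / ((fact r)\<^sup>2 * (fact s)\<^sup>2)) / (real n - 1)"
      by blast
  qed
next
  fix \<alpha> :: real
  assume "0 < \<alpha> \<and> \<alpha> \<le> 0.17"
  hence "0 < \<alpha>" "\<alpha> < 1 / 2" by auto
  \<comment> \<open>Since \<open>2 s = \<alpha> n\<close>, the parameter itself is the ratio of the
    degree \<open>2 * s\<close> to \<open>n\<close>.\<close>
  then obtain N where N: "\<And>n d t. n \<ge> N \<and> even d \<and> real d = \<alpha> * real n \<and> t \<le> n \<longrightarrow>
      kraw n t d \<ge> - (real (n choose d) / (real n - 1))"
    using kraw_ge_linear_degree by meson
  show "\<exists>N::nat. \<forall>r s n :: nat.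
      r \<ge> s \<and> even r \<and> n = 2 * (r + s) \<and> real s = \<alpha> * (real n / 2) \<and> n \<ge> N \<longrightarrow>
      complex_of_real (lambda_min r s) = lambda_type r s (0, 1, n - 2, 1) \<and>
      lambda_min r s = - (fact n / ((fact r)\<^sup>2 * (fact s)\<^sup>2)) / (real n - 1)"
  proof (intro exI[of _ "max N 2"] allI impI, elim conjE)
    fix r s n :: nat
    assume r: "even r" and n_eq: "n = 2 * (r + s)" and s: "real s = \<alpha> * (real n / 2)" and n: "n \<ge> max N 2"
    have "kraw n t (2 * s) \<ge> - (real (n choose (2 * s)) / (real n - 1))" if "t \<le> n" for t
      using N[of n "2 * s" t] s n that by simp
    moreover have "n \<ge> 2" using n by simp
    ultimately show "complex_of_real (lambda_min r s) = lambda_type r s (0, 1, n - 2, 1) \<and>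
        lambda_min r s = - (fact n / ((fact r)\<^sup>2 * (fact s)\<^sup>2)) / (real n - 1)"
      using lambda_min_eq_if_kraw_ge[OF n_eq r] by blast
  qed
qed

end
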